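(* Let $G$ be a locally compact, locally trivial groupoid with unit space $G^{(0)}$, and let $x\in G^{(0)}$. Consider the following statements: (1) $G$ has a Haar system; (2) the transversal $G^x$ has a $G_x^x$-invariant fully supported Radon measure for the left multiplication action of $G_x^x$ on $G^x$; (3) $G^{(0)}$ has a fully supported Radon measure. Then (1)$\iff$(2) and (3)$\implies$(2). If $G^{(0)}$ is paracompact, then (2)$\implies$(3).
   Context: **Groupoids.** For a groupoid $G$ with range and source maps $r,s\colon G\to G^{(0)}$ (arrows compose right to left: $\gamma\eta$ is defined iff $s(\gamma)=r(\eta)$), put $G^x=r^{-1}(x)$, $G_y=s^{-1}(y)$, $G^x_y=G^x\cap G_y$; $G_x^x$ is the isotropy group at $x$. A topological groupoid is a groupoid with a topology for which $r$, $s$, inversion and multiplication are continuous ($G^{(0)}\subseteq G$ with the subspace topology). It is called locally compact if its topology is locally compact (not assumed Hausdorff, but locally Hausdorff: every point has a compact Hausdorff neighbourhood) and its unit space $G^{(0)}$ is Hausdorff. $G$ is locally trivial if for every $x\in G^{(0)}$ the restricted source map $s|_{G^x}\colon G^x\to G^{(0)}$ is a surjective local homeomorphism. Paracompact spaces are assumed Hausdorff. **Measures.** Measures are positive Radon measures; "fully supported" means the support is the whole space. A Haar system on $G$ is a family $\{\alpha^u\}_{u\in G^{(0)}}$ of positive Radon measures on $G$ such that: $\alpha^u$ has support $G^u$; for every $f\in C_c(G)$ the function $u\mapsto\int f\,d\alpha^u$ is in $C_c(G^{(0)})$; and for all $\gamma\in G$, $f\in C_c(G)$, $\int_{G^{s(\gamma)}}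 f(\gamma\eta)\,d\alpha^{s(\gamma)}(\eta)=\int_{G^{r(\gamma)}} f(\eta)\,d\alpha^{r(\gamma)}(\eta)$. *)

theory Defs
  imports "HOL-Analysis.Analysis"
begin

text \<open>Groupoids are given by their arrows; units are identified with their identity arrows, and the
  set of arrows is the underlying set of the topology. The product \<open>gmult G a b\<close> is only
  meaningful when \<open>gsrc G a = grng G b\<close>.\<close>

record 'a top_groupoid =
  gtop  :: "'a topology"
  units :: "'a set"
  grng  :: "'a \<Rightarrow> 'a"
  gsrc  :: "'a \<Rightarrow> 'a"
  gmult :: "'a \<Rightarrow> 'a \<Rightarrow> 'a"
  ginv  :: "'a \<Rightarrow> 'a"

definition arrows :: "'a top_groupoid \<Rightarrow> 'a set" where
  "arrows G = topspace (gtop G)"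

definition composable :: "'a top_groupoid \<Rightarrow> ('a \<times> 'a) set" where
  "composable G = {(a, b). a \<in> arrows G \<and> b \<in> arrows G \<and> gsrc G a = grng G b}"

definition groupoid :: "'a top_groupoid \<Rightarrow> bool" where
  "groupoid G \<longleftrightarrow>
     units G \<subseteq> arrows G \<and>
     (\<forall>u \<in> units G. grng G u = u \<and> gsrc G u = u) \<and>
     (\<forall>a \<in> arrows G. grng G a \<in> units G \<and> gsrc G a \<in> units G \<and>
        gmult G (grng G a) a = a \<and> gmult G a (gsrc G a) = a) \<and>
     (\<forall>(a, b) \<in> composable G. gmult G a b \<in> arrows G \<and>
        grng G (gmult G a b) = grng G a \<and> gsrc G (gmult G a b) = gsrc G b) \<and>
     (\<forall>a b c. (a, b) \<in> composable G \<longrightarrow> (b, c) \<in> composable G \<longrightarrow>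
        gmult G (gmult G a b) c = gmult G a (gmult G b c)) \<and>
     (\<forall>a \<in> arrows G. ginv G a \<in> arrows G \<and>
        grng G (ginv G a) = gsrc G a \<and> gsrc G (ginv G a) = grng G a \<and>
        gmult G (ginv G a) a = gsrc G a \<and> gmult G a (ginv G a) = grng G a)"

definition unit_top :: "'a top_groupoid \<Rightarrow> 'a topology" where
  "unit_top G = subtopology (gtop G) (units G)"

definition rfib :: "'a top_groupoid \<Rightarrow> 'a \<Rightarrow> 'a set" where
  "rfib G x = {a \<in> arrows G. grng G a = x}"

definition rfib_top :: "'a top_groupoid \<Rightarrow> 'a \<Rightarrow> 'a topology" where
  "rfib_top G x = subtopology (gtop G) (rfib G x)"

definition isotropy :: "'a top_groupoid \<Rightarrow> 'a \<Rightarrow> 'a set" where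
  "isotropy G x = {a \<in> arrows G. grng G a = x \<and> gsrc G a = x}"

definition topological_groupoid :: "'a top_groupoid \<Rightarrow> bool" where
  "topological_groupoid G \<longleftrightarrow>
     groupoid G \<and>
     continuous_map (gtop G) (unit_top G) (grng G) \<and>
     continuous_map (gtop G) (unit_top G) (gsrc G) \<and>
     continuous_map (gtop G) (gtop G) (ginv G) \<and>
     continuous_map (subtopology (prod_topology (gtop G) (gtop G)) (composable G)) (gtop G)
       (\<lambda>(a, b). gmult G a b)"

text \<open>Arrow spaces need not be Hausdorff, so local compactness asks for compact \<^emph>\<open>Hausdorff\<close>
  neighbourhoods; the library's \<^const>\<open>locally_compact_space\<close> does not.\<close>

definition locally_compact_groupoid :: "'a top_groupoid \<Rightarrow> bool" where
  "locally_compact_groupoid G \<longleftrightarrow>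
     topological_groupoid G \<and>
     (\<forall>a \<in> arrows G. \<exists>U K. openin (gtop G) U \<and> a \<in> U \<and> U \<subseteq> K \<and>
        compactin (gtop G) K \<and> Hausdorff_space (subtopology (gtop G) K)) \<and>
     Hausdorff_space (unit_top G)"

definition local_homeomorphism :: "'a topology \<Rightarrow> 'b topology \<Rightarrow> ('a \<Rightarrow> 'b) \<Rightarrow> bool" where
  "local_homeomorphism X Y f \<longleftrightarrow>
     (\<forall>p \<in> topspace X. \<exists>U. openin X U \<and> p \<in> U \<and> openin Y (f ` U) \<and>
        homeomorphic_map (subtopology X U) (subtopology Y (f ` U)) f)"

definition locally_trivial :: "'a top_groupoid \<Rightarrow> bool" where
  "locally_trivial G \<longleftrightarrow>
     (\<forall>x \<in> units G. gsrc G ` rfib G x = units G \<and>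
        local_homeomorphism (rfib_top G x) (unit_top G) (gsrc G))"

definition paracompact_space :: "'a topology \<Rightarrow> bool" where
  "paracompact_space X \<longleftrightarrow>
     Hausdorff_space X \<and>
     (\<forall>\<U>. (\<forall>U \<in> \<U>. openin X U) \<and> \<Union>\<U> = topspace X \<longrightarrow>
        (\<exists>\<V>. (\<forall>V \<in> \<V>. openin X V) \<and> \<Union>\<V> = topspace X \<and>
           (\<forall>V \<in> \<V>. \<exists>U \<in> \<U>. V \<subseteq> U) \<and> locally_finite_in X \<V>))"

text \<open>A (positive) Radon measure is a locally finite Borel measure that is inner regular with
  respect to compact sets. In a space that is only locally Hausdorff, compact sets need not be
  Borel, whence the condition \<open>K \<in> sets M\<close> below.\<close>

definition radon_measure :: "'a topology \<Rightarrow> 'a measure \<Rightarrow> bool" where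
  "radon_measure X M \<longleftrightarrow>
     space M = topspace X \<and>
     sets M = sigma_sets (topspace X) {U. openin X U} \<and>
     (\<forall>p \<in> topspace X. \<exists>U. openin X U \<and> p \<in> U \<and> emeasure M U < \<infinity>) \<and>
     (\<forall>B \<in> sets M. emeasure M B = (SUP K \<in> {K \<in> sets M. K \<subseteq> B \<and> compactin X K}. emeasure M K))"

definition measure_support :: "'a topology \<Rightarrow> 'a measure \<Rightarrow> 'a set" where
  "measure_support X M = {p \<in> topspace X. \<forall>U. openin X U \<and> p \<in> U \<longrightarrow> emeasure M U \<noteq> 0}"

definition fully_supported :: "'a topology \<Rightarrow> 'a measure \<Rightarrow> bool" where
  "fully_supported X M \<longleftrightarrow> measure_support X M = topspace X"

text \<open>For a locally Hausdorff space, \<open>C\<^sub>c(X)\<close> is Connes' space: the linear span of the continuous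
  compactly supported functions on open Hausdorff subsets \<open>U\<close>, extended by zero. If \<open>X\<close> is
  Hausdorff these are just the continuous functions with compact support. (Values outside
  \<open>topspace X\<close> are unconstrained; the span needs no scaling rule because the generators are
  closed under scalar multiples.)\<close>

inductive_set Cc :: "'a topology \<Rightarrow> ('a \<Rightarrow> complex) set" for X :: "'a topology" where
  generator: "\<lbrakk>openin X U; Hausdorff_space (subtopology X U);
     continuous_map (subtopology X U) euclidean f;
     compactin X K; K \<subseteq> U; \<And>p. p \<in> topspace X - K \<Longrightarrow> f p = 0\<rbrakk> \<Longrightarrow> f \<in> Cc X"
| add: "\<lbrakk>f \<in> Cc X; g \<in> Cc X\<rbrakk> \<Longrightarrow> (\<lambda>p. f p + g p) \<in> Cc X"

definition haar_system :: "'a top_groupoid \<Rightarrow> ('a \<Rightarrow> 'a measure) \<Rightarrow> bool" where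
  "haar_system G \<alpha> \<longleftrightarrow>
     (\<forall>u \<in> units G. radon_measure (gtop G) (\<alpha> u) \<and> measure_support (gtop G) (\<alpha> u) = rfib G u) \<and>
     (\<forall>f \<in> Cc (gtop G). (\<lambda>u. \<integral>\<eta>. f \<eta> \<partial>(\<alpha> u)) \<in> Cc (unit_top G)) \<and>
     (\<forall>\<gamma> \<in> arrows G. \<forall>f \<in> Cc (gtop G).
        (LINT \<eta>:rfib G (gsrc G \<gamma>)|\<alpha> (gsrc G \<gamma>). f (gmult G \<gamma> \<eta>)) =
        (LINT \<eta>:rfib G (grng G \<gamma>)|\<alpha> (grng G \<gamma>). f \<eta>))"

definition isotropy_invariant :: "'a top_groupoid \<Rightarrow> 'a \<Rightarrow> 'a measure \<Rightarrow> bool" where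
  "isotropy_invariant G x M \<longleftrightarrow>
     (\<forall>g \<in> isotropy G x. \<forall>B \<in> sets M. emeasure M (gmult G g ` B) = emeasure M B)"

end

theory Submission
  imports Defs
begin

text \<open>No countability is assumed, so the measures need not be sigma-finite and families of
  small open sets may be uncountable. Inner regularity takes the place of countability: a compact
  set is covered by finitely many members of an open cover, so inequalities checked on small open
  sets pass to all Borel sets. Gluing follows the same pattern, as a supremum over finite families
  of charts. The Hausdorff property of \<open>G\<close> is what makes measure theory on the whole
  arrow space work: compact sets become Borel and of finite measure, \<open>Cc\<close> becomes the
  usual space of continuous compactly supported functions, and Urysohn functions recover a Radon
  measure from its integrals. In the Haar system the arrow from \<open>x\<close> to \<open>u\<close>
  is chosen with no continuity in \<open>u\<close>. Because the resulting measure is independent of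
  the choice, the arrow can be replaced whenever convenient: by a local section to get continuity in
  \<open>u\<close>, and by a product of arrows to get left invariance.\<close>

text \<open>By local triviality \<open>G\<close> is locally a product of an open set of units, a discrete isotropy group
  and another open set of units. So \<open>G\<close> is Hausdorff and \<open>s : G\<^sup>x \<rightarrow> G\<^sup>0\<close> is a covering
  with the discrete group \<open>G\<^sup>x\<^sub>x\<close> as deck transformations. Compatible Radon measures on the members
  of an open cover glue to a unique Radon measure. Hence a measure on \<open>G\<^sup>0\<close> lifts sheet by sheet to
  an invariant measure on \<open>G\<^sup>x\<close>, and an invariant measure on \<open>G\<^sup>x\<close> descends along sheets.
  Left translation by any arrow from \<open>x\<close> to \<open>u\<close> carries an invariant measure on \<open>G\<^sup>x\<close> to a
  measure on \<open>G\<^sup>u\<close> that does not depend on the arrow, which gives a Haar system. Conversely, the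
  member at \<open>x\<close> of a Haar system restricts to \<open>G\<^sup>x\<close>, and invariance of its integrals on compactly
  supported functions implies invariance of the measure.\<close>

section \<open>Radon measures\<close>

text \<open>Serves only as a carrier of the Borel sigma-algebra, for measurability statements and as
  the target of \<open>distr\<close>; as a measure it is zero.\<close>

definition borel_of :: "'a topology \<Rightarrow> 'a measure" where
  "borel_of X = sigma (topspace X) {U. openin X U}"

lemma space_borel_of [simp]: "space (borel_of X) = topspace X"
  unfolding borel_of_def by (rule space_measure_of) (auto dest: openin_subset)

lemma sets_borel_of: "sets (borel_of X) = sigma_sets (topspace X) {U. openin X U}"
  unfolding borel_of_def by (rule sets_measure_of) (auto dest: openin_subset)

lemma openin_borel_of: "openin X U \<Longrightarrow> U \<in> sets (borel_of X)"
  by (simp add: sets_borel_of sigma_sets.Basic)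

lemma closedin_borel_of: "closedin X C \<Longrightarrow> C \<in> sets (borel_of X)"
  by (metis closedin_def double_diff openin_borel_of order_refl sets.compl_sets space_borel_of)

lemma compactin_borel_of: "Hausdorff_space X \<Longrightarrow> compactin X C \<Longrightarrow> C \<in> sets (borel_of X)"
  by (simp add: closedin_borel_of compactin_imp_closedin)

lemma measurable_borel_of:
  assumes "continuous_map X Y f"
  shows "f \<in> measurable (borel_of X) (borel_of Y)"
  unfolding borel_of_def[of Y]
proof (rule measurable_measure_of)
  show "{U. openin Y U} \<subseteq> Pow (topspace Y)"
    by (auto dest: openin_subset)
  show "f \<in> space (borel_of X) \<rightarrow> topspace Y"
    using continuous_map_funspace[OF assms] by simp
  fix V assume "V \<in> {U. openin Y U}"
  then have "openin X {p \<in> topspace X. f p \<in> V}"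
    using openin_continuous_map_preimage[OF assms] by blast
  moreover have "f -` V \<inter> space (borel_of X) = {p \<in> topspace X. f p \<in> V}"
    by auto
  ultimately show "f -` V \<inter> space (borel_of X) \<in> sets (borel_of X)"
    by (simp add: openin_borel_of)
qed

lemma sets_borel_of_euclidean: "sets (borel_of euclidean) = sets borel"
  by (simp add: sets_borel_of borel_def)

lemma borel_measurable_continuous_map:
  assumes "continuous_map X euclidean f"
  shows "f \<in> borel_measurable (borel_of X)"
  using measurable_borel_of[OF assms] measurable_cong_sets[OF refl sets_borel_of_euclidean] by blast

text \<open>Traces of a generating family generate the trace sigma-algebra. This is what allows
  Borel subsets of a sheet or of a range fibre to be measured in the ambient space.\<close>

lemma sets_borel_of_subtopology:
  assumes "S \<in> sets (borel_of X)"
  shows "sets (borel_of (subtopology X S)) = sets (restrict_space (borel_of X) S)"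
proof -
  have S: "S \<subseteq> topspace X"
    using sets.sets_into_space[OF assms] by simp
  have "(\<inter>) S ` {U. openin X U} = {U. openin (subtopology X S) U}"
    by (auto simp: openin_subtopology image_iff)
  moreover have "topspace (subtopology X S) = S"
    using S by auto
  ultimately show ?thesis
    using sigma_sets_Int[of S "topspace X" "{U. openin X U}"] assms S
    by (simp add: sets_restrict_space sets_borel_of)
qed

lemma sets_borel_of_subtopology_iff:
  assumes "S \<in> sets (borel_of X)"
  shows "B \<in> sets (borel_of (subtopology X S)) \<longleftrightarrow> B \<in> sets (borel_of X) \<and> B \<subseteq> S"
  using assms sets.sets_into_space[OF assms]
  by (subst sets_borel_of_subtopology[OF assms], subst sets_restrict_space_iff)
    (auto simp: Int_absorb2)

lemma radon_measure_iff:
  "radon_measure X M \<longleftrightarrow>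
     sets M = sets (borel_of X) \<and>
     (\<forall>p \<in> topspace X. \<exists>U. openin X U \<and> p \<in> U \<and> emeasure M U < \<infinity>) \<and>
     (\<forall>B \<in> sets M. emeasure M B = (SUP K \<in> {K \<in> sets M. K \<subseteq> B \<and> compactin X K}. emeasure M K))"
  unfolding radon_measure_def sets_borel_of[symmetric]
  using sets_eq_imp_space_eq[of M "borel_of X"] by auto

lemma radon_measure_space: "radon_measure X M \<Longrightarrow> space M = topspace X"
  by (simp add: radon_measure_def)

lemma radon_measure_sets: "radon_measure X M \<Longrightarrow> sets M = sets (borel_of X)"
  by (simp add: radon_measure_iff)

text \<open>Finitely many open sets of finite measure cover \<open>K\<close>. An open superset is
  provided because outer approximation of compact sets starts from one.\<close>

lemma radon_measure_compact_finite:
  assumes M: "radon_measure X M" and K: "compactin X K"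
  obtains U where "openin X U" "K \<subseteq> U" "emeasure M U < \<infinity>"
proof -
  let ?\<U> = "{U. openin X U \<and> emeasure M U < \<infinity>}"
  have "K \<subseteq> \<Union>?\<U>"
  proof
    fix p assume "p \<in> K"
    then have "p \<in> topspace X"
      using compactin_subset_topspace[OF K] by blast
    then obtain U where "openin X U" "p \<in> U" "emeasure M U < \<infinity>"
      using M by (auto simp: radon_measure_iff)
    then show "p \<in> \<Union>?\<U>"
      by blast
  qed
  then obtain \<F> where \<F>: "finite \<F>" "\<F> \<subseteq> ?\<U>" "K \<subseteq> \<Union>\<F>"
    using compactinD[OF K, of ?\<U>] by blast
  have "(\<lambda>U. U) ` \<F> \<subseteq> sets M"
    using \<F>(2) openin_borel_of by (auto simp: radon_measure_sets[OF M])
  from emeasure_subadditive_finite[OF \<F>(1) this]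
  have "emeasure M (\<Union>\<F>) \<le> (\<Sum>U\<in>\<F>. emeasure M U)"
    by simp
  also have "\<dots> < \<infinity>"
    using \<F>(1,2) by (auto simp: sum_Pinfty less_top)
  finally show ?thesis
    using that[of "\<Union>\<F>"] \<F> by blast
qed

lemma radon_measure_emeasure_compact_finite:
  assumes X: "Hausdorff_space X" and M: "radon_measure X M" and K: "compactin X K"
  shows "emeasure M K < \<infinity>"
proof -
  obtain U where U: "openin X U" "K \<subseteq> U" "emeasure M U < \<infinity>"
    using radon_measure_compact_finite[OF M K] .
  have "emeasure M K \<le> emeasure M U"
    using U openin_borel_of[OF U(1)] by (intro emeasure_mono) (simp_all add: radon_measure_sets[OF M])
  then show ?thesis
    using U(3) by order
qed

text \<open>Inner regularity reduces the claim to compact subsets of \<open>A\<close>, and each of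
  these meets the cover in finitely many members. Inner regularity of \<open>M\<close> is asked only
  at the set \<open>A\<close>, so the lemma also applies to chart measures that are controlled only
  inside their chart.\<close>

lemma emeasure_le_of_local_le:
  assumes M: "sets M = sets (borel_of X)" and N: "sets N = sets (borel_of X)"
    and A: "A \<in> sets (borel_of X)"
    and inner: "emeasure M A \<le> (SUP K \<in> {K \<in> sets M. K \<subseteq> A \<and> compactin X K}. emeasure M K)"
    and cover: "A \<subseteq> \<Union>\<W>" and op: "\<And>W. W \<in> \<W> \<Longrightarrow> openin X W"
    and le: "\<And>W B. W \<in> \<W> \<Longrightarrow> B \<in> sets (borel_of X) \<Longrightarrow> B \<subseteq> A \<inter> W \<Longrightarrow> emeasure M B \<le> emeasure N B"
  shows "emeasure M A \<le> emeasure N A"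
proof -
  \<comment> \<open>Each induction step cuts \<open>B\<close> into the disjoint pieces
    \<open>B \<inter> W\<close> and \<open>B - W\<close>, so overlaps of the cover are not counted
    twice.\<close>
  have fin: "emeasure M B \<le> emeasure N B"
    if "finite \<F>" "\<F> \<subseteq> \<W>" "B \<in> sets (borel_of X)" "B \<subseteq> A \<inter> \<Union>\<F>" for \<F> B
    using that
  proof (induction \<F> arbitrary: B rule: finite_induct)
    case (insert W \<F>)
    have W: "W \<in> sets (borel_of X)"
      using insert.prems(1) op openin_borel_of by blast
    have "emeasure M B = emeasure M (B \<inter> W) + emeasure M (B - W)"
      by (subst plus_emeasure) (use insert.prems(2) W M in \<open>auto intro!: arg_cong[where f="emeasure M"]\<close>)
    also have "\<dots> \<le> emeasure N (B \<inter> W) + emeasure N (B - W)"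
      using insert.prems W by (intro add_mono le insert.IH) auto
    also have "\<dots> = emeasure N B"
      by (subst plus_emeasure) (use insert.prems(2) W N in \<open>auto intro!: arg_cong[where f="emeasure N"]\<close>)
    finally show ?case .
  qed simp
  have "emeasure M K \<le> emeasure N A" if K: "K \<in> sets M" "K \<subseteq> A" "compactin X K" for K
  proof -
    obtain \<F> where "finite \<F>" "\<F> \<subseteq> \<W>" "K \<subseteq> \<Union>\<F>"
      using compactinD[OF K(3), of \<W>] op cover K(2) by blast
    then have "emeasure M K \<le> emeasure N K"
      using fin[of \<F> K] K M by auto
    also have "\<dots> \<le> emeasure N A"
      using K A N by (intro emeasure_mono) auto
    finally show ?thesis .
  qed
  then have "(SUP K \<in> {K \<in> sets M. K \<subseteq> A \<and> compactin X K}. emeasure M K) \<le> emeasure N A"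
    by (intro SUP_least) auto
  with inner show ?thesis
    by order
qed

text \<open>The uniqueness half of gluing: both measures are inner regular, so the local comparison
  runs in both directions.\<close>

lemma radon_measure_eqI_local:
  assumes M: "radon_measure X M" and N: "radon_measure X N"
    and cover: "topspace X \<subseteq> \<Union>\<W>" and op: "\<And>W. W \<in> \<W> \<Longrightarrow> openin X W"
    and eq: "\<And>W B. W \<in> \<W> \<Longrightarrow> B \<in> sets (borel_of X) \<Longrightarrow> B \<subseteq> W \<Longrightarrow> emeasure M B = emeasure N B"
  shows "M = N"
proof (rule measure_eqI)
  show "sets M = sets N"
    using M N by (simp add: radon_measure_iff)
  fix A assume "A \<in> sets M"
  then have A: "A \<in> sets (borel_of X)"
    using M by (simp add: radon_measure_iff)
  have cA: "A \<subseteq> \<Union>\<W>"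
    using cover sets.sets_into_space[OF A] by auto
  show "emeasure M A = emeasure N A"
    by (intro antisym emeasure_le_of_local_le[OF _ _ A _ cA op])
      (use M N A in \<open>simp_all add: radon_measure_iff eq\<close>)
qed

subsection \<open>Gluing\<close>

text \<open>The charts in the list are made disjoint in list order: each chart measures the part of
  \<open>B\<close> that no earlier chart has taken. The recursion turns additivity and independence
  of the list into inductions.\<close>

fun glue :: "('i \<Rightarrow> 'a measure) \<Rightarrow> ('i \<Rightarrow> 'a set) \<Rightarrow> 'i list \<Rightarrow> 'a set \<Rightarrow> ennreal" where
  "glue M U [] B = 0"
| "glue M U (i # l) B = emeasure (M i) (B \<inter> U i) + glue M U l (B - U i)"

text \<open>Every \<open>M i\<close> is a measure on all of \<open>X\<close>, but local finiteness,
  compatibility and inner regularity are demanded only inside \<open>U i\<close>. This fits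
  push-forwards from a single sheet, about which nothing is known elsewhere.\<close>

locale compatible_measures =
  fixes X :: "'a topology" and I :: "'i set" and M :: "'i \<Rightarrow> 'a measure" and U :: "'i \<Rightarrow> 'a set"
  assumes sets_M: "i \<in> I \<Longrightarrow> sets (M i) = sets (borel_of X)"
    and open_U: "i \<in> I \<Longrightarrow> openin X (U i)"
    and cover: "topspace X \<subseteq> (\<Union>i\<in>I. U i)"
    and compat: "i \<in> I \<Longrightarrow> j \<in> I \<Longrightarrow> B \<in> sets (borel_of X) \<Longrightarrow> B \<subseteq> U i \<inter> U j \<Longrightarrow>
      emeasure (M i) B = emeasure (M j) B"
    and locally_finite: "i \<in> I \<Longrightarrow> p \<in> U i \<Longrightarrow>
      \<exists>V. openin X V \<and> p \<in> V \<and> V \<subseteq> U i \<and> emeasure (M i) V < \<infinity>"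
    and inner: "i \<in> I \<Longrightarrow> B \<in> sets (borel_of X) \<Longrightarrow> B \<subseteq> U i \<Longrightarrow>
      emeasure (M i) B \<le> (SUP K \<in> {K \<in> sets (borel_of X). K \<subseteq> B \<and> compactin X K}. emeasure (M i) K)"
begin

lemma U_borel: "i \<in> I \<Longrightarrow> U i \<in> sets (borel_of X)"
  using open_U openin_borel_of by blast

lemma glue_countably_additive:
  assumes "set l \<subseteq> I" "range A \<subseteq> sets (borel_of X)" "disjoint_family A"
  shows "(\<Sum>n. glue M U l (A n)) = glue M U l (\<Union>n. A n)"
  using assms
proof (induction l arbitrary: A)
  case (Cons i l)
  have "(\<Sum>n. glue M U (i # l) (A n)) =
      (\<Sum>n. emeasure (M i) (A n \<inter> U i)) + (\<Sum>n. glue M U l (A n - U i))"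
    by (simp add: suminf_add)
  moreover have "(\<Sum>n. emeasure (M i) (A n \<inter> U i)) = emeasure (M i) (\<Union>n. A n \<inter> U i)"
  proof (rule suminf_emeasure)
    show "range (\<lambda>n. A n \<inter> U i) \<subseteq> sets (M i)"
      using Cons.prems U_borel sets_M[of i] by fastforce
    show "disjoint_family (\<lambda>n. A n \<inter> U i)"
      using Cons.prems(3) by (auto simp: disjoint_family_on_def)
  qed
  moreover have "(\<Sum>n. glue M U l (A n - U i)) = glue M U l (\<Union>n. A n - U i)"
  proof (rule Cons.IH)
    show "range (\<lambda>n. A n - U i) \<subseteq> sets (borel_of X)"
      using Cons.prems U_borel by fastforce
    show "disjoint_family (\<lambda>n. A n - U i)"
      using Cons.prems(3) by (auto simp: disjoint_family_on_def)
  qed (use Cons.prems in auto)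
  moreover have "(\<Union>n. A n \<inter> U i) = (\<Union>n. A n) \<inter> U i" "(\<Union>n. A n - U i) = (\<Union>n. A n) - U i"
    by auto
  ultimately show ?case
    by simp
qed simp

lemma glue_empty [simp]: "glue M U l {} = 0"
  by (induction l) auto

lemma glue_split:
  assumes "set l \<subseteq> I" "B \<in> sets (borel_of X)" "C \<in> sets (borel_of X)"
  shows "glue M U l B = glue M U l (B \<inter> C) + glue M U l (B - C)"
  using assms
proof (induction l arbitrary: B)
  case (Cons i l)
  have "B \<inter> U i = (B \<inter> C \<inter> U i) \<union> ((B - C) \<inter> U i)"
    by auto
  then have "emeasure (M i) (B \<inter> U i) = emeasure (M i) (B \<inter> C \<inter> U i) + emeasure (M i) ((B - C) \<inter> U i)"
    by (subst plus_emeasure) (use Cons.prems U_borel[of i] sets_M[of i] in auto)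
  moreover have "glue M U l (B - U i) = glue M U l ((B - U i) \<inter> C) + glue M U l (B - U i - C)"
    using Cons.prems U_borel[of i] by (intro Cons.IH) auto
  moreover have "(B - U i) \<inter> C = B \<inter> C - U i" "B - U i - C = B - C - U i"
    by auto
  ultimately show ?case
    by (simp add: add_ac)
qed simp

lemma glue_mono:
  assumes "set l \<subseteq> I" "B \<in> sets (borel_of X)" "C \<in> sets (borel_of X)" "B \<subseteq> C"
  shows "glue M U l B \<le> glue M U l C"
  using glue_split[OF assms(1,3,2)] assms(4) by (simp add: Int_absorb1)

text \<open>On pieces lying in \<open>U i\<close>, compatibility replaces every chart measure by
  \<open>M i\<close>, and the disjoint pieces then add up to \<open>B\<close>.\<close>

lemma glue_in_chart:
  assumes "set l \<subseteq> I" "i \<in> I" "B \<in> sets (borel_of X)" "B \<subseteq> U i" "B \<subseteq> (\<Union>j\<in>set l. U j)"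
  shows "glue M U l B = emeasure (M i) B"
  using assms
proof (induction l arbitrary: B)
  case (Cons j l)
  have j: "j \<in> I" "U j \<in> sets (borel_of X)"
    using Cons.prems U_borel by auto
  have "emeasure (M j) (B \<inter> U j) = emeasure (M i) (B \<inter> U j)"
    using Cons.prems j by (intro compat) auto
  moreover have "glue M U l (B - U j) = emeasure (M i) (B - U j)"
    using Cons.prems j by (intro Cons.IH) auto
  moreover have "emeasure (M i) (B \<inter> U j) + emeasure (M i) (B - U j) = emeasure (M i) B"
    by (subst plus_emeasure) (use Cons.prems j sets_M[of i] in \<open>auto intro!: arg_cong[where f="emeasure (M i)"]\<close>)
  ultimately show ?case
    by simp
qed simp

text \<open>Independence of the chosen charts. Induction is on \<open>l\<close> alone: the piece
  \<open>B \<inter> U i\<close> lies in one chart, so \<open>glue_in_chart\<close> evaluates it for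
  the whole list \<open>l'\<close>, and \<open>glue_split\<close> reassembles the two
  pieces.\<close>

lemma glue_cong:
  assumes "set l \<subseteq> I" "set l' \<subseteq> I" "B \<in> sets (borel_of X)"
    "B \<subseteq> (\<Union>j\<in>set l. U j)" "B \<subseteq> (\<Union>j\<in>set l'. U j)"
  shows "glue M U l B = glue M U l' B"
  using assms
proof (induction l arbitrary: B)
  case (Cons i l)
  have i: "i \<in> I" "U i \<in> sets (borel_of X)"
    using Cons.prems U_borel by auto
  have "emeasure (M i) (B \<inter> U i) = glue M U l' (B \<inter> U i)"
    using Cons.prems i by (subst glue_in_chart[of l' i]) auto
  moreover have "glue M U l (B - U i) = glue M U l' (B - U i)"
    using Cons.prems i by (intro Cons.IH) auto
  ultimately show ?case
    using glue_split[OF Cons.prems(2,3) i(2)] by simp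
qed simp

lemma glue_restrict:
  assumes "set l \<subseteq> I" "B \<in> sets (borel_of X)"
  shows "glue M U l B = glue M U l (B \<inter> (\<Union>j\<in>set l. U j))"
proof -
  let ?C = "\<Union>j\<in>set l. U j"
  have C: "?C \<in> sets (borel_of X)"
    using assms(1) U_borel by (intro sets.finite_UN) auto
  have "glue M U l B = 0" if "B \<inter> (\<Union>j\<in>set l. U j) = {}" for B
    using that
  proof (induction l arbitrary: B)
    case (Cons i l)
    then have "B \<inter> U i = {}" "(B - U i) \<inter> (\<Union>j\<in>set l. U j) = {}"
      by auto
    with Cons.IH show ?case
      by simp
  qed simp
  then show ?thesis
    using glue_split[OF assms C] by (metis Diff_disjoint Int_commute add.right_neutral)
qed

text \<open>Monotonicity in the list. It makes the family of lists directed, with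
  \<open>l @ l'\<close> above both \<open>l\<close> and \<open>l'\<close>.\<close>

lemma glue_le_append:
  assumes "set l \<subseteq> I" "set l' \<subseteq> I" "set l \<subseteq> set l'" "B \<in> sets (borel_of X)"
  shows "glue M U l B \<le> glue M U l' B"
proof -
  let ?C = "\<Union>j\<in>set l. U j"
  have C: "?C \<in> sets (borel_of X)"
    using assms(1) U_borel by (intro sets.finite_UN) auto
  have "glue M U l B = glue M U l (B \<inter> ?C)"
    by (rule glue_restrict) (use assms in auto)
  also have "\<dots> = glue M U l' (B \<inter> ?C)"
    by (rule glue_cong) (use assms C in auto)
  also have "\<dots> \<le> glue M U l' B"
    by (rule glue_mono) (use assms C in auto)
  finally show ?thesis .
qed

text \<open>Since a cover need not have a finite or countable subcover, the value is a supremum over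
  all finite lists of charts.\<close>

definition glued :: "'a measure" where
  "glued = measure_of (topspace X) {V. openin X V} (\<lambda>B. SUP l \<in> lists I. glue M U l B)"

lemma sets_glued [simp]: "sets glued = sets (borel_of X)"
  unfolding glued_def sets_borel_of by (rule sets_measure_of) (auto dest: openin_subset)

lemma emeasure_glued:
  assumes "B \<in> sets (borel_of X)"
  shows "emeasure glued B = (SUP l \<in> lists I. glue M U l B)"
proof (rule emeasure_measure_of[OF glued_def])
  show "{V. openin X V} \<subseteq> Pow (topspace X)"
    by (auto dest: openin_subset)
  show "positive (sets glued) (\<lambda>B. SUP l \<in> lists I. glue M U l B)"
    by (auto simp: positive_def intro!: SUP_eq_const)
  show "countably_additive (sets glued) (\<lambda>B. SUP l \<in> lists I. glue M U l B)"
    unfolding countably_additive_def sets_glued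
  proof (intro allI impI)
    fix A :: "nat \<Rightarrow> 'a set"
    assume A: "range A \<subseteq> sets (borel_of X)" "disjoint_family A"
    \<comment> \<open>Countable additivity of a supremum of measures rests on directedness, which
      allows the supremum to be exchanged with the infinite sum.\<close>
    have "(\<Sum>n. SUP l \<in> lists I. glue M U l (A n)) = (SUP l \<in> lists I. \<Sum>n. glue M U l (A n))"
    proof (rule ennreal_suminf_SUP_eq_directed)
      fix N :: "nat set" and l l' assume l: "l \<in> lists I" "l' \<in> lists I"
      then have "set l \<subseteq> I" "set l' \<subseteq> I"
        by auto
      then have "\<forall>n\<in>N. glue M U l (A n) \<le> glue M U (l @ l') (A n) \<and>
          glue M U l' (A n) \<le> glue M U (l @ l') (A n)"
        using A(1) by (intro ballI conjI glue_le_append) auto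
      then show "\<exists>k\<in>lists I. \<forall>n\<in>N. glue M U l (A n) \<le> glue M U k (A n) \<and>
          glue M U l' (A n) \<le> glue M U k (A n)"
        using l by (intro bexI[of _ "l @ l'"]) auto
    qed
    also have "\<dots> = (SUP l \<in> lists I. glue M U l (\<Union>n. A n))"
      by (rule SUP_cong[OF refl], rule glue_countably_additive) (use A in auto)
    finally show "(\<Sum>n. SUP l \<in> lists I. glue M U l (A n)) = (SUP l \<in> lists I. glue M U l (\<Union>n. A n))" .
  qed
  show "B \<in> sets glued"
    using assms by simp
qed

text \<open>Inside one chart no list can exceed \<open>M i\<close>, because it sees only the part of
  \<open>B\<close> that its charts cover; the list \<open>[i]\<close> attains the bound.\<close>

lemma emeasure_glued_chart:
  assumes "i \<in> I" "B \<in> sets (borel_of X)" "B \<subseteq> U i"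
  shows "emeasure glued B = emeasure (M i) B"
  unfolding emeasure_glued[OF assms(2)]
proof (rule antisym)
  show "(SUP l \<in> lists I. glue M U l B) \<le> emeasure (M i) B"
  proof (rule SUP_least)
    fix l assume "l \<in> lists I"
    then have l: "set l \<subseteq> I"
      by auto
    let ?C = "\<Union>j\<in>set l. U j"
    have C: "?C \<in> sets (borel_of X)"
      using l U_borel by (intro sets.finite_UN) auto
    have "glue M U l B = glue M U l (B \<inter> ?C)"
      by (rule glue_restrict) (use assms l in auto)
    also have "\<dots> = emeasure (M i) (B \<inter> ?C)"
      by (rule glue_in_chart) (use assms l C in auto)
    also have "\<dots> \<le> emeasure (M i) B"
      by (rule emeasure_mono) (use assms sets_M[OF assms(1)] in auto)
    finally show "glue M U l B \<le> emeasure (M i) B" .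
  qed
  have "glue M U [i] B = emeasure (M i) B"
    by (rule glue_in_chart) (use assms in auto)
  then show "emeasure (M i) B \<le> (SUP l \<in> lists I. glue M U l B)"
    using assms(1) by (intro SUP_upper2[of "[i]"]) auto
qed

text \<open>A compact subset of \<open>B \<inter> U i\<close> and one of \<open>B - U i\<close> have
  a compact disjoint union in \<open>B\<close>, so inner approximations of the two pieces
  combine.\<close>

lemma glue_le_inner:
  assumes "set l \<subseteq> I" "B \<in> sets (borel_of X)"
  shows "glue M U l B \<le> (SUP K \<in> {K \<in> sets (borel_of X). K \<subseteq> B \<and> compactin X K}. emeasure glued K)"
  using assms
proof (induction l arbitrary: B)
  case (Cons i l)
  let ?K = "\<lambda>B. {K \<in> sets (borel_of X). K \<subseteq> B \<and> compactin X K}"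
  have i: "i \<in> I" "U i \<in> sets (borel_of X)" and l: "set l \<subseteq> I"
    using Cons.prems U_borel by auto
  have ne: "?K C \<noteq> {}" for C
    by blast
  have "emeasure (M i) (B \<inter> U i) \<le> (SUP K \<in> ?K (B \<inter> U i). emeasure (M i) K)"
    using Cons.prems i by (intro inner) auto
  also have "\<dots> = (SUP K \<in> ?K (B \<inter> U i). emeasure glued K)"
    using i by (intro SUP_cong refl) (auto simp: emeasure_glued_chart)
  finally have "glue M U (i # l) B \<le>
      (SUP K \<in> ?K (B \<inter> U i). emeasure glued K) + (SUP K \<in> ?K (B - U i). emeasure glued K)"
    using Cons.IH[OF l, of "B - U i"] Cons.prems(2) i by (auto intro!: add_mono)
  \<comment> \<open>Sums of suprema become a double supremum; the index sets are nonempty because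
    they contain the empty set.\<close>
  also have "\<dots> = (SUP K \<in> ?K (B \<inter> U i). emeasure glued K + (SUP K \<in> ?K (B - U i). emeasure glued K))"
    by (rule ennreal_SUP_add_left[symmetric, OF ne])
  also have "\<dots> = (SUP K \<in> ?K (B \<inter> U i). SUP K' \<in> ?K (B - U i). emeasure glued K + emeasure glued K')"
    by (intro SUP_cong refl ennreal_SUP_add_right ne)
  also have "\<dots> \<le> (SUP K \<in> ?K B. emeasure glued K)"
  proof (intro SUP_least)
    fix K K' assume K: "K \<in> ?K (B \<inter> U i)" "K' \<in> ?K (B - U i)"
    then have "emeasure glued K + emeasure glued K' = emeasure glued (K \<union> K')"
      by (intro plus_emeasure) auto
    also have "\<dots> \<le> (SUP K \<in> ?K B. emeasure glued K)"
      using K by (intro SUP_upper) (auto intro: compactin_Un)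
    finally show "emeasure glued K + emeasure glued K' \<le> (SUP K \<in> ?K B. emeasure glued K)" .
  qed
  finally show ?case .
qed simp

lemma radon_measure_glued: "radon_measure X glued"
  unfolding radon_measure_iff
proof (intro conjI ballI)
  fix p assume "p \<in> topspace X"
  then obtain i where i: "i \<in> I" "p \<in> U i"
    using cover by auto
  then obtain V where "openin X V" "p \<in> V" "V \<subseteq> U i" "emeasure (M i) V < \<infinity>"
    using locally_finite by blast
  then show "\<exists>V. openin X V \<and> p \<in> V \<and> emeasure glued V < \<infinity>"
    using i by (auto simp: emeasure_glued_chart openin_borel_of)
next
  fix B assume "B \<in> sets glued"
  then have B: "B \<in> sets (borel_of X)"
    by simp
  show "emeasure glued B = (SUP K \<in> {K \<in> sets glued. K \<subseteq> B \<and> compactin X K}. emeasure glued K)"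
  proof (rule antisym)
    show "emeasure glued B \<le> (SUP K \<in> {K \<in> sets glued. K \<subseteq> B \<and> compactin X K}. emeasure glued K)"
      unfolding emeasure_glued[OF B] sets_glued
    proof (rule SUP_least)
      fix l assume "l \<in> lists I"
      then show "glue M U l B \<le> (SUP K \<in> {K \<in> sets (borel_of X). K \<subseteq> B \<and> compactin X K}. emeasure glued K)"
        using glue_le_inner[OF _ B] by auto
    qed
  qed (use B in \<open>auto intro!: SUP_least emeasure_mono\<close>)
qed simp

end

subsection \<open>Comparison through compactly supported functions\<close>

text \<open>Outer regularity at compact sets comes from inner regularity of a complement: inside an
  open neighbourhood \<open>U\<close> of finite measure, a compact \<open>L\<close> nearly exhausts
  \<open>U - K\<close>, and \<open>U - L\<close> is the required open set, with excess
  \<open>U - K - L\<close>.\<close>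

lemma radon_measure_outer_compact:
  assumes X: "Hausdorff_space X" and M: "radon_measure X M" and K: "compactin X K" and e: "0 < (e::real)"
  obtains V where "openin X V" "K \<subseteq> V" "emeasure M V \<le> emeasure M K + ennreal e"
proof -
  have sM: "sets M = sets (borel_of X)"
    using M by (simp add: radon_measure_iff)
  have KM: "K \<in> sets M"
    using compactin_borel_of[OF X K] sM by simp
  obtain U where U: "openin X U" "K \<subseteq> U" "emeasure M U < \<infinity>"
    using radon_measure_compact_finite[OF M K] .
  have UM: "U \<in> sets M"
    using openin_borel_of[OF U(1)] sM by simp
  let ?\<K> = "{L \<in> sets M. L \<subseteq> U - K \<and> compactin X L}"
  have "emeasure M (U - K) \<le> emeasure M U"
    using UM by (intro emeasure_mono) auto
  then have fin: "emeasure M (U - K) \<noteq> \<infinity>"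
    using U(3) by auto
  have "emeasure M (U - K) = (SUP L \<in> ?\<K>. emeasure M L)"
    using M UM KM by (auto simp: radon_measure_iff)
  then obtain L where L: "L \<in> sets M" "L \<subseteq> U - K" "compactin X L"
      and Le: "emeasure M (U - K) < emeasure M L + ennreal e"
    using SUP_approx_ennreal[OF e, of ?\<K> _ "emeasure M"] fin by blast
  show ?thesis
  proof
    show "openin X (U - L)"
      using U(1) L(3) X by (simp add: compactin_imp_closedin openin_diff)
    show "K \<subseteq> U - L"
      using U(2) L(2) by blast
    have "emeasure M L + emeasure M (U - K - L) = emeasure M (U - K)"
      by (subst plus_emeasure) (use L UM KM in \<open>auto intro!: arg_cong[where f="emeasure M"]\<close>)
    with Le have "emeasure M L + emeasure M (U - K - L) \<le> emeasure M L + ennreal e"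
      by simp
    moreover have "emeasure M L \<le> emeasure M (U - K)"
      using L UM KM by (intro emeasure_mono) auto
    ultimately have "emeasure M (U - K - L) \<le> ennreal e"
      using fin by (auto simp: ennreal_add_left_cancel_le top_unique)
    moreover have "emeasure M (U - L) = emeasure M K + emeasure M (U - K - L)"
      by (subst plus_emeasure) (use L U UM KM in \<open>auto intro!: arg_cong[where f="emeasure M"]\<close>)
    ultimately show "emeasure M (U - L) \<le> emeasure M K + ennreal e"
      by (simp add: add_left_mono)
  qed
qed

text \<open>A Urysohn function that is 1 on \<open>K\<close> and vanishes off \<open>V\<close> gives
  the chain M(K) \<le> \<integral>f dM = \<integral>f dN \<le> N(V) \<le> N(K) + e, with
  \<open>V\<close> an outer approximation of \<open>K\<close> for \<open>N\<close>.\<close>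

lemma emeasure_compact_le_of_Cc:
  assumes X: "Hausdorff_space X" "locally_compact_space X"
    and M: "radon_measure X M" and N: "radon_measure X N"
    and eq: "\<And>f. f \<in> Cc X \<Longrightarrow> (\<integral>p. f p \<partial>M) = (\<integral>p. f p \<partial>N)"
    and K: "compactin X K"
  shows "emeasure M K \<le> emeasure N K"
proof (rule ennreal_le_epsilon)
  fix e :: real assume "0 < e"
  have sM: "sets M = sets (borel_of X)" and sN: "sets N = sets (borel_of X)"
    using M N by (simp_all add: radon_measure_iff)
  have spM: "space M = topspace X" and spN: "space N = topspace X"
    using M N by (simp_all add: radon_measure_def)
  obtain V where V: "openin X V" "K \<subseteq> V" "emeasure N V \<le> emeasure N K + ennreal e"
    using radon_measure_outer_compact[OF X(1) N K \<open>0 < e\<close>] by auto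
  \<comment> \<open>The function will also vanish off \<open>W\<close>, so the compact set
    \<open>L\<close> bounds its support and it belongs to \<open>Cc X\<close>.\<close>
  obtain W L where W: "openin X W" "compactin X L" "K \<subseteq> W" "W \<subseteq> L"
    using X K locally_compact_space_compact_closed_compact[of X] by blast
  have L: "L \<in> sets (borel_of X)"
    using X(1) W(2) by (rule compactin_borel_of)
  have creg: "completely_regular_space X"
    using X locally_compact_Hausdorff_imp_regular_space
      locally_compact_regular_imp_completely_regular_space by blast
  have clo: "closedin X (topspace X - (V \<inter> W))"
    using V W by blast
  have disj: "disjnt K (topspace X - (V \<inter> W))"
    using V W by (auto simp: disjnt_def)
  obtain f where "continuous_map X (subtopology euclidean {0..1::real}) f"
      and f0: "f ` (topspace X - (V \<inter> W)) \<subseteq> {0}" and f1: "f ` K \<subseteq> {1}"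
    by (rule Urysohn_completely_regular_compact_closed[OF zero_le_one creg K clo disj])
  then have f: "continuous_map X euclideanreal f" and f01: "\<And>p. p \<in> topspace X \<Longrightarrow> 0 \<le> f p \<and> f p \<le> 1"
    by (auto simp: continuous_map_in_subtopology Pi_iff)
  have cf: "(\<lambda>p. complex_of_real (f p)) \<in> Cc X"
  proof (rule Cc.generator)
    show "openin X (topspace X)" "Hausdorff_space (subtopology X (topspace X))"
      using X(1) by auto
    show "continuous_map (subtopology X (topspace X)) euclidean (\<lambda>p. complex_of_real (f p))"
      using continuous_map_compose[OF f, of euclidean complex_of_real]
      by (simp add: o_def continuous_on_of_real_id)
    show "compactin X L" "L \<subseteq> topspace X"
      using W(2) compactin_subset_topspace by auto
    show "complex_of_real (f p) = 0" if "p \<in> topspace X - L" for p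
      using that f0 W(4) by fastforce
  qed
  \<comment> \<open>Integrability is what permits passing between the Bochner integrals of the
    hypothesis and the nonnegative integrals of the estimate: without it a Bochner integral defaults
    to 0.\<close>
  have int: "integrable \<mu> f" and nn: "(\<integral>\<^sup>+p. ennreal (f p) \<partial>\<mu>) = ennreal (\<integral>p. f p \<partial>\<mu>)"
    if \<mu>: "radon_measure X \<mu>" for \<mu>
  proof -
    have s\<mu>: "sets \<mu> = sets (borel_of X)" "space \<mu> = topspace X"
      using \<mu> by (simp_all add: radon_measure_sets radon_measure_space)
    show int: "integrable \<mu> f"
    proof (rule integrableI_bounded_set[where A=L and B=1])
      show "L \<in> sets \<mu>"
        using L s\<mu> by simp
      show "f \<in> borel_measurable \<mu>"
        using borel_measurable_continuous_map[OF f] measurable_cong_sets[OF s\<mu>(1) refl] by blast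
      show "emeasure \<mu> L < \<infinity>"
        by (rule radon_measure_emeasure_compact_finite[OF X(1) \<mu> W(2)])
      show "AE p in \<mu>. p \<in> L \<longrightarrow> norm (f p) \<le> 1"
        using f01 s\<mu>(2) by (intro AE_I2) auto
      show "AE p in \<mu>. p \<notin> L \<longrightarrow> f p = 0"
        using f0 W(4) s\<mu>(2) by (intro AE_I2) fastforce
    qed
    show "(\<integral>\<^sup>+p. ennreal (f p) \<partial>\<mu>) = ennreal (\<integral>p. f p \<partial>\<mu>)"
      by (rule nn_integral_eq_integral[OF int]) (use f01 s\<mu>(2) in auto)
  qed
  have "emeasure M K = (\<integral>\<^sup>+p. indicator K p \<partial>M)"
    using compactin_borel_of[OF X(1) K] sM by simp
  also have "\<dots> \<le> (\<integral>\<^sup>+p. ennreal (f p) \<partial>M)"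
    using f1 by (intro nn_integral_mono) (auto simp: indicator_def)
  also have "\<dots> = (\<integral>\<^sup>+p. ennreal (f p) \<partial>N)"
    using eq[OF cf] by (simp add: nn[OF M] nn[OF N])
  also have "\<dots> \<le> (\<integral>\<^sup>+p. indicator V p \<partial>N)"
    using f0 f01 spN by (intro nn_integral_mono) (fastforce simp: indicator_def)
  also have "\<dots> = emeasure N V"
    using openin_borel_of[OF V(1)] sN by simp
  finally show "emeasure M K \<le> emeasure N K + ennreal e"
    using V(3) by order
qed

lemma radon_measure_eqI_compact:
  assumes M: "radon_measure X M" and N: "radon_measure X N"
    and eq: "\<And>K. compactin X K \<Longrightarrow> emeasure M K = emeasure N K"
  shows "M = N"
proof (rule measure_eqI)
  show s: "sets M = sets N"
    using M N by (simp add: radon_measure_iff)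
  fix B assume "B \<in> sets M"
  then show "emeasure M B = emeasure N B"
    using M N s eq by (auto simp: radon_measure_iff intro!: SUP_cong)
qed

lemma radon_measure_eqI_Cc:
  assumes "Hausdorff_space X" "locally_compact_space X"
    and "radon_measure X M" and "radon_measure X N"
    and "\<And>f. f \<in> Cc X \<Longrightarrow> (\<integral>p. f p \<partial>M) = (\<integral>p. f p \<partial>N)"
  shows "M = N"
  by (rule radon_measure_eqI_compact) (use assms in \<open>auto intro!: antisym emeasure_compact_le_of_Cc\<close>)

subsection \<open>Closed embeddings and restrictions\<close>

text \<open>At a point outside \<open>C\<close>, closedness supplies a neighbourhood of measure
  zero; at a point of \<open>C\<close>, the image of a small open set is the trace of an open set of
  \<open>X\<close>. Images of compact sets carry over inner regularity. This moves measures from a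
  range fibre into the whole arrow space.\<close>

lemma radon_measure_distr:
  assumes X: "Hausdorff_space X" and M: "radon_measure Y M"
    and C: "closedin X C" and f: "homeomorphic_map Y (subtopology X C) f"
  shows "radon_measure X (distr M (borel_of X) f)"
proof -
  let ?N = "distr M (borel_of X) f"
  have sM: "sets M = sets (borel_of Y)" "space M = topspace Y"
    using M by (simp_all add: radon_measure_sets radon_measure_space)
  have C': "C \<subseteq> topspace X"
    using C closedin_subset by blast
  have cf: "continuous_map Y X f"
    using f homeomorphic_imp_continuous_map continuous_map_into_fulltopology by blast
  have fY: "f ` topspace Y = C"
    using homeomorphic_imp_surjective_map[OF f] C' by auto
  have mf: "f \<in> measurable M (borel_of X)"
    using measurable_borel_of[OF cf] measurable_cong_sets[OF sM(1) refl] by blast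
  have em: "emeasure ?N B = emeasure M {a \<in> topspace Y. f a \<in> B}" if "B \<in> sets (borel_of X)" for B
    using emeasure_distr[OF mf that] by (simp add: sM(2) vimage_def Int_def conj_commute)
  show ?thesis
    unfolding radon_measure_iff
  proof (intro conjI ballI)
    fix p assume p: "p \<in> topspace X"
    show "\<exists>U. openin X U \<and> p \<in> U \<and> emeasure ?N U < \<infinity>"
    proof (cases "p \<in> C")
      case False
      have "openin X (topspace X - C)"
        using C by blast
      moreover have "{a \<in> topspace Y. f a \<in> topspace X - C} = {}"
        using fY by auto
      ultimately have "emeasure ?N (topspace X - C) = 0"
        by (simp only: em[OF openin_borel_of] emeasure_empty)
      then show ?thesis
        using False p \<open>openin X (topspace X - C)\<close> by (intro exI[of _ "topspace X - C"]) auto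
    next
      case True
      then obtain a where a: "a \<in> topspace Y" "f a = p"
        using fY by auto
      then obtain V where V: "openin Y V" "a \<in> V" "emeasure M V < \<infinity>"
        using M by (auto simp: radon_measure_iff)
      have "openin (subtopology X C) (f ` V)"
        using f V(1) homeomorphic_imp_open_map open_map_def by metis
      then obtain U where U: "openin X U" "f ` V = U \<inter> C"
        by (auto simp: openin_subtopology)
      have "{a \<in> topspace Y. f a \<in> U} \<subseteq> V"
      proof safe
        fix b assume b: "b \<in> topspace Y" "f b \<in> U"
        then have "f b \<in> f ` V"
          using U(2) fY by auto
        then show "b \<in> V"
          using homeomorphic_imp_injective_map[OF f] b(1) openin_subset[OF V(1)]
          by (auto simp: inj_on_def)
      qed
      then have "emeasure ?N U \<le> emeasure M V"
        using V(1) U(1) sM by (auto simp: em openin_borel_of intro!: emeasure_mono)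
      then show ?thesis
        using U a V by (intro exI[of _ U]) auto
    qed
  next
    fix B assume "B \<in> sets ?N"
    then have B: "B \<in> sets (borel_of X)"
      by simp
    let ?\<K> = "{K \<in> sets ?N. K \<subseteq> B \<and> compactin X K}"
    have "{a \<in> topspace Y. f a \<in> B} \<in> sets M"
      using measurable_sets[OF mf B] by (simp add: sM(2) vimage_def Int_def conj_commute)
    then have "emeasure ?N B = (SUP K \<in> {K \<in> sets M. K \<subseteq> {a \<in> topspace Y. f a \<in> B} \<and> compactin Y K}. emeasure M K)"
      using M em[OF B] by (auto simp: radon_measure_iff)
    also have "\<dots> \<le> (SUP K \<in> ?\<K>. emeasure ?N K)"
    proof (rule SUP_least)
      fix K assume "K \<in> {K \<in> sets M. K \<subseteq> {a \<in> topspace Y. f a \<in> B} \<and> compactin Y K}"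
      then have K: "K \<in> sets M" "K \<subseteq> {a \<in> topspace Y. f a \<in> B}" "compactin Y K"
        by auto
      have fK: "compactin X (f ` K)"
        using image_compactin[OF K(3) cf] .
      have fK': "f ` K \<in> sets (borel_of X)"
        using compactin_borel_of[OF X fK] .
      have "{a \<in> topspace Y. f a \<in> f ` K} \<in> sets M"
        using measurable_sets[OF mf fK'] by (simp add: sM(2) vimage_def Int_def conj_commute)
      then have "emeasure M K \<le> emeasure ?N (f ` K)"
        unfolding em[OF fK'] using K compactin_subset_topspace[OF K(3)] by (intro emeasure_mono) auto
      also have "\<dots> \<le> (SUP K \<in> ?\<K>. emeasure ?N K)"
        using K fK fK' by (intro SUP_upper) auto
      finally show "emeasure M K \<le> (SUP K \<in> ?\<K>. emeasure ?N K)" .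
    qed
    finally show "emeasure ?N B = (SUP K \<in> ?\<K>. emeasure ?N K)"
      using B by (intro antisym) (auto intro!: SUP_least emeasure_mono)
  qed simp
qed

lemma radon_measure_restrict:
  assumes M: "radon_measure X M" and C: "closedin X C"
  shows "radon_measure (subtopology X C) (restrict_space M C)"
proof -
  have sM: "sets M = sets (borel_of X)" "space M = topspace X"
    using M by (simp_all add: radon_measure_sets radon_measure_space)
  have Cb: "C \<in> sets (borel_of X)" "C \<subseteq> topspace X"
    using closedin_borel_of[OF C] closedin_subset[OF C] by auto
  have sR: "B \<in> sets (restrict_space M C) \<longleftrightarrow> B \<in> sets M \<and> B \<subseteq> C" for B
    using Cb sM by (subst sets_restrict_space_iff) (auto simp: Int_absorb2)
  have em: "emeasure (restrict_space M C) B = emeasure M B" if "B \<subseteq> C" for B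
    using Cb sM that by (intro emeasure_restrict_space) (auto simp: Int_absorb2)
  show ?thesis
    unfolding radon_measure_iff
  proof (intro conjI ballI)
    show "sets (restrict_space M C) = sets (borel_of (subtopology X C))"
      using sets_borel_of_subtopology[OF Cb(1)] sM(1) by (simp add: sets_restrict_space)
    fix p assume "p \<in> topspace (subtopology X C)"
    then have p: "p \<in> topspace X" "p \<in> C"
      by auto
    then obtain U where U: "openin X U" "p \<in> U" "emeasure M U < \<infinity>"
      using M by (auto simp: radon_measure_iff)
    have "emeasure M (U \<inter> C) \<le> emeasure M U"
      using U(1) sM openin_borel_of by (intro emeasure_mono) auto
    then show "\<exists>U. openin (subtopology X C) U \<and> p \<in> U \<and> emeasure (restrict_space M C) U < \<infinity>"
      using U p by (intro exI[of _ "U \<inter> C"]) (auto simp: em openin_subtopology)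
  next
    fix B assume "B \<in> sets (restrict_space M C)"
    then have B: "B \<in> sets M" "B \<subseteq> C"
      using sR by auto
    have "{K \<in> sets (restrict_space M C). K \<subseteq> B \<and> compactin (subtopology X C) K} =
        {K \<in> sets M. K \<subseteq> B \<and> compactin X K}"
      using B by (auto simp: sR compactin_subtopology)
    moreover have "emeasure M B = (SUP K \<in> {K \<in> sets M. K \<subseteq> B \<and> compactin X K}. emeasure M K)"
      using M B(1) by (auto simp: radon_measure_iff)
    ultimately show "emeasure (restrict_space M C) B =
        (SUP K \<in> {K \<in> sets (restrict_space M C). K \<subseteq> B \<and> compactin (subtopology X C) K}.
          emeasure (restrict_space M C) K)"
      using B by (auto simp: em intro!: SUP_cong)
  qed
qed

section \<open>Transport of measures along local homeomorphisms\<close>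

definition sheet :: "'a topology \<Rightarrow> 'b topology \<Rightarrow> ('a \<Rightarrow> 'b) \<Rightarrow> 'a set \<Rightarrow> bool" where
  "sheet X Y p U \<longleftrightarrow> openin X U \<and> openin Y (p ` U) \<and>
     homeomorphic_map (subtopology X U) (subtopology Y (p ` U)) p"

lemma local_homeomorphism_sheet:
  assumes "local_homeomorphism X Y p" "a \<in> topspace X"
  obtains U where "sheet X Y p U" "a \<in> U"
  using assms unfolding local_homeomorphism_def sheet_def by blast

context
  fixes X :: "'a topology" and Y :: "'b topology" and p U
  assumes U: "sheet X Y p U"
begin

lemma sheet_open: "openin X U" and sheet_image_open: "openin Y (p ` U)"
  using U by (auto simp: sheet_def)

lemma sheet_homeomorphic: "homeomorphic_map (subtopology X U) (subtopology Y (p ` U)) p"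
  using U by (auto simp: sheet_def)

lemma sheet_topspace: "topspace (subtopology X U) = U" "topspace (subtopology Y (p ` U)) = p ` U"
  using sheet_open sheet_image_open openin_subset by fastforce+

lemma sheet_inj: "inj_on p U"
  using homeomorphic_imp_injective_map[OF sheet_homeomorphic] by (simp only: sheet_topspace)

lemma sheet_continuous: "continuous_map (subtopology X U) Y p"
  using homeomorphic_imp_continuous_map[OF sheet_homeomorphic] continuous_map_into_fulltopology by blast

text \<open>The inverse is fixed as \<open>inv_into U p\<close>, the map used below both for
  push-forwards and for local sections of the source map.\<close>

lemma sheet_inverse_continuous: "continuous_map (subtopology Y (p ` U)) (subtopology X U) (inv_into U p)"
proof -
  obtain g where g: "homeomorphic_maps (subtopology X U) (subtopology Y (p ` U)) p g"
    using sheet_homeomorphic homeomorphic_map_maps by blast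
  then have "continuous_map (subtopology Y (p ` U)) (subtopology X U) g"
    by (simp add: homeomorphic_maps_def)
  moreover have "g y = inv_into U p y" if "y \<in> topspace (subtopology Y (p ` U))" for y
    using g that sheet_inj unfolding homeomorphic_maps_def sheet_topspace
    by (metis image_iff inv_into_f_f)
  ultimately show ?thesis
    by (rule continuous_map_eq)
qed

lemma sheet_openin_image:
  assumes "openin X V" "V \<subseteq> U"
  shows "openin Y (p ` V)"
proof -
  have "openin (subtopology X U) V"
    using assms openin_subset_topspace_eq openin_open_subtopology[OF sheet_open] by blast
  then have "openin (subtopology Y (p ` U)) (p ` V)"
    using homeomorphic_imp_open_map[OF sheet_homeomorphic] by (auto simp: open_map_def)
  then show ?thesis
    using openin_open_subtopology[OF sheet_image_open] by blast
qed

lemma sheet_openin_preimage: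
  assumes "openin Y W"
  shows "openin X {a \<in> U. p a \<in> W}"
proof -
  have "openin (subtopology X U) {a \<in> U. p a \<in> W}"
    using openin_continuous_map_preimage[OF sheet_continuous assms] by (simp only: sheet_topspace)
  then show ?thesis
    using openin_open_subtopology[OF sheet_open] by blast
qed

lemma sheet_borel: "U \<in> sets (borel_of X)" "p ` U \<in> sets (borel_of Y)"
  using sheet_open sheet_image_open openin_borel_of by auto

lemma sheet_borel_preimage:
  assumes "B \<in> sets (borel_of Y)"
  shows "{a \<in> U. p a \<in> B} \<in> sets (borel_of X)"
proof -
  have "{a \<in> U. p a \<in> B} = p -` B \<inter> space (borel_of (subtopology X U))"
    by (simp only: sheet_topspace space_borel_of) auto
  then have "{a \<in> U. p a \<in> B} \<in> sets (borel_of (subtopology X U))"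
    using measurable_sets[OF measurable_borel_of[OF sheet_continuous] assms] by simp
  then show ?thesis
    using sets_borel_of_subtopology_iff[OF sheet_borel(1)] by blast
qed

lemma sheet_inv_vimage:
  assumes "B \<subseteq> U"
  shows "inv_into U p -` B \<inter> p ` U = p ` B"
  using assms sheet_inj by (auto simp: inv_into_f_f)

lemma sheet_borel_image:
  assumes "B \<in> sets (borel_of X)" "B \<subseteq> U"
  shows "p ` B \<in> sets (borel_of Y)"
proof -
  have "B \<in> sets (borel_of (subtopology X U))"
    using sets_borel_of_subtopology_iff[OF sheet_borel(1)] assms by blast
  then have "inv_into U p -` B \<inter> space (borel_of (subtopology Y (p ` U))) \<in> sets (borel_of (subtopology Y (p ` U)))"
    by (rule measurable_sets[OF measurable_borel_of[OF sheet_inverse_continuous]])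
  then have "p ` B \<in> sets (borel_of (subtopology Y (p ` U)))"
    by (simp only: space_borel_of sheet_topspace sheet_inv_vimage[OF assms(2)])
  then show ?thesis
    using sets_borel_of_subtopology_iff[OF sheet_borel(2)] by blast
qed

lemma sheet_compact_image: "compactin X K \<Longrightarrow> K \<subseteq> U \<Longrightarrow> compactin Y (p ` K)"
  using image_compactin[OF _ sheet_continuous] by (auto simp: compactin_subtopology)

lemma sheet_compact_preimage:
  assumes "compactin Y K" "K \<subseteq> p ` U"
  shows "compactin X {a \<in> U. p a \<in> K}"
proof -
  have "compactin (subtopology X U) (inv_into U p ` K)"
    by (rule image_compactin[OF _ sheet_inverse_continuous]) (use assms in \<open>simp add: compactin_subtopology\<close>)
  moreover have "inv_into U p ` K = {a \<in> U. p a \<in> K}"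
  proof (intro equalityI subsetI)
    fix a assume "a \<in> inv_into U p ` K"
    then show "a \<in> {a \<in> U. p a \<in> K}"
      using assms(2) by (auto simp: inv_into_into f_inv_into_f subset_iff)
  next
    fix a assume "a \<in> {a \<in> U. p a \<in> K}"
    then show "a \<in> inv_into U p ` K"
      using inv_into_f_f[OF sheet_inj, of a] by force
  qed
  ultimately show ?thesis
    by (simp add: compactin_subtopology)
qed

end

lemma radon_measure_pullback:
  assumes p: "local_homeomorphism X Y p" and \<nu>: "radon_measure Y \<nu>"
  obtains \<mu> where "radon_measure X \<mu>"
    "\<And>U B. sheet X Y p U \<Longrightarrow> B \<in> sets (borel_of X) \<Longrightarrow> B \<subseteq> U \<Longrightarrow> emeasure \<mu> B = emeasure \<nu> (p ` B)"
proof -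
  have s\<nu>: "sets \<nu> = sets (borel_of Y)" "space \<nu> = topspace Y"
    using \<nu> by (simp_all add: radon_measure_sets radon_measure_space)
  define M where "M U = distr (restrict_space \<nu> (p ` U)) (borel_of X) (inv_into U p)" for U
  \<comment> \<open>\<open>M U\<close> is a measure on all of \<open>X\<close>, concentrated on
    \<open>U\<close>; hence the intersection with \<open>U\<close>.\<close>
  have M: "emeasure (M U) B = emeasure \<nu> (p ` (B \<inter> U))" if U: "sheet X Y p U" and B: "B \<in> sets (borel_of X)" for U B
  proof -
    have pU: "p ` U \<in> sets \<nu>" "p ` U \<subseteq> topspace Y"
      using sheet_borel[OF U] s\<nu> openin_subset[OF sheet_image_open[OF U]] by auto
    have "sets (restrict_space \<nu> (p ` U)) = sets (borel_of (subtopology Y (p ` U)))"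
      using sets_borel_of_subtopology[OF sheet_borel(2)[OF U]] s\<nu> by (simp add: sets_restrict_space)
    then have "inv_into U p \<in> measurable (restrict_space \<nu> (p ` U)) (borel_of X)"
      using measurable_borel_of[OF continuous_map_into_fulltopology[OF sheet_inverse_continuous[OF U]]]
        measurable_cong_sets by blast
    then have "emeasure (M U) B = emeasure (restrict_space \<nu> (p ` U)) (inv_into U p -` B \<inter> space (restrict_space \<nu> (p ` U)))"
      unfolding M_def using B by (intro emeasure_distr)
    also have "inv_into U p -` B \<inter> space (restrict_space \<nu> (p ` U)) = p ` (B \<inter> U)"
      using sheet_inv_vimage[OF U, of "B \<inter> U"] pU s\<nu>(2)
      by (auto simp: space_restrict_space inv_into_into)
    also have "emeasure (restrict_space \<nu> (p ` U)) (p ` (B \<inter> U)) = emeasure \<nu> (p ` (B \<inter> U))"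
      using pU s\<nu> by (intro emeasure_restrict_space) (auto simp: Int_absorb2)
    finally show ?thesis .
  qed
  interpret compatible_measures X "{U. sheet X Y p U}" M "\<lambda>U. U"
  proof
    show "topspace X \<subseteq> (\<Union>U\<in>{U. sheet X Y p U}. U)"
      using local_homeomorphism_sheet[OF p] by blast
  next
    fix U assume "U \<in> {U. sheet X Y p U}"
    then show "sets (M U) = sets (borel_of X)" "openin X U"
      by (simp_all add: M_def sheet_open)
  next
    fix U V B assume "U \<in> {U. sheet X Y p U}" "V \<in> {U. sheet X Y p U}" "B \<in> sets (borel_of X)" "B \<subseteq> U \<inter> V"
    then show "emeasure (M U) B = emeasure (M V) B"
      by (simp add: M Int_absorb2)
  next
    fix U a assume "U \<in> {U. sheet X Y p U}" and a: "a \<in> U"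
    then have U: "sheet X Y p U"
      by simp
    have "p a \<in> topspace Y"
      using a openin_subset[OF sheet_image_open[OF U]] by auto
    then obtain W where W: "openin Y W" "p a \<in> W" "emeasure \<nu> W < \<infinity>"
      using \<nu> by (auto simp: radon_measure_iff)
    let ?V = "{a \<in> U. p a \<in> W}"
    have V: "openin X ?V"
      using sheet_openin_preimage[OF U W(1)] .
    have "emeasure (M U) ?V \<le> emeasure \<nu> W"
      using V W(1) s\<nu> by (auto simp: M[OF U] openin_borel_of intro!: emeasure_mono)
    then show "\<exists>V. openin X V \<and> a \<in> V \<and> V \<subseteq> U \<and> emeasure (M U) V < \<infinity>"
      using V W a by (intro exI[of _ ?V]) auto
  next
    fix U B assume "U \<in> {U. sheet X Y p U}" and B: "B \<in> sets (borel_of X)" "B \<subseteq> U"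
    then have U: "sheet X Y p U"
      by simp
    have "emeasure (M U) B = (SUP K \<in> {K \<in> sets \<nu>. K \<subseteq> p ` B \<and> compactin Y K}. emeasure \<nu> K)"
      using \<nu> sheet_borel_image[OF U B] B s\<nu> by (auto simp: M[OF U] radon_measure_iff Int_absorb2)
    also have "\<dots> \<le> (SUP K \<in> {K \<in> sets (borel_of X). K \<subseteq> B \<and> compactin X K}. emeasure (M U) K)"
    proof (rule SUP_least)
      fix K assume "K \<in> {K \<in> sets \<nu>. K \<subseteq> p ` B \<and> compactin Y K}"
      then have K: "K \<in> sets (borel_of Y)" "K \<subseteq> p ` B" "compactin Y K"
        using s\<nu> by auto
      let ?L = "{a \<in> U. p a \<in> K}"
      have pL: "p ` (?L \<inter> U) = K" and L: "?L \<subseteq> B"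
        using K(2) B(2) sheet_inj[OF U] by (auto simp: inj_on_def subset_iff)
      have "emeasure \<nu> K = emeasure (M U) ?L"
        using M[OF U sheet_borel_preimage[OF U K(1)]] pL by simp
      also have "\<dots> \<le> (SUP K \<in> {K \<in> sets (borel_of X). K \<subseteq> B \<and> compactin X K}. emeasure (M U) K)"
        using sheet_borel_preimage[OF U K(1)] sheet_compact_preimage[OF U K(3)] K(2) B(2) L
        by (intro SUP_upper) auto
      finally show "emeasure \<nu> K \<le> (SUP K \<in> {K \<in> sets (borel_of X). K \<subseteq> B \<and> compactin X K}. emeasure (M U) K)" .
    qed
    finally show "emeasure (M U) B \<le> (SUP K \<in> {K \<in> sets (borel_of X). K \<subseteq> B \<and> compactin X K}. emeasure (M U) K)" .
  qed
  show thesis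
  proof
    show "radon_measure X glued"
      by (rule radon_measure_glued)
    fix U B assume "sheet X Y p U" "B \<in> sets (borel_of X)" "B \<subseteq> U"
    then show "emeasure glued B = emeasure \<nu> (p ` B)"
      by (simp add: emeasure_glued_chart M Int_absorb2)
  qed
qed

text \<open>Different sheets over the same point may induce different measures below, so agreement
  is a hypothesis here. It is asked only near each common point \<open>q\<close>, because an
  isotropy element that matches two sheets at \<open>q\<close> may fail to match them
  elsewhere.\<close>

lemma radon_measure_descend:
  assumes p: "local_homeomorphism X Y p" and surj: "topspace Y \<subseteq> p ` topspace X"
    and \<mu>: "radon_measure X \<mu>"
    and compat: "\<And>U V q. sheet X Y p U \<Longrightarrow> sheet X Y p V \<Longrightarrow> q \<in> p ` U \<inter> p ` V \<Longrightarrow>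
      \<exists>W. openin Y W \<and> q \<in> W \<and> (\<forall>B \<in> sets (borel_of Y). B \<subseteq> W \<longrightarrow>
        emeasure \<mu> {a \<in> U. p a \<in> B} = emeasure \<mu> {a \<in> V. p a \<in> B})"
  obtains \<nu> where "radon_measure Y \<nu>"
    "\<And>U B. sheet X Y p U \<Longrightarrow> B \<in> sets (borel_of Y) \<Longrightarrow> B \<subseteq> p ` U \<Longrightarrow>
      emeasure \<nu> B = emeasure \<mu> {a \<in> U. p a \<in> B}"
proof -
  have s\<mu>: "sets \<mu> = sets (borel_of X)" "space \<mu> = topspace X"
    using \<mu> by (simp_all add: radon_measure_sets radon_measure_space)
  define M where "M U = distr (restrict_space \<mu> U) (borel_of Y) p" for U
  have M: "emeasure (M U) B = emeasure \<mu> {a \<in> U. p a \<in> B}" if U: "sheet X Y p U" and B: "B \<in> sets (borel_of Y)" for U B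
  proof -
    have U': "U \<in> sets \<mu>" "U \<subseteq> topspace X"
      using sheet_borel[OF U] s\<mu> openin_subset[OF sheet_open[OF U]] by auto
    have "sets (restrict_space \<mu> U) = sets (borel_of (subtopology X U))"
      using sets_borel_of_subtopology[OF sheet_borel(1)[OF U]] s\<mu> by (simp add: sets_restrict_space)
    then have "p \<in> measurable (restrict_space \<mu> U) (borel_of Y)"
      using measurable_borel_of[OF sheet_continuous[OF U]] measurable_cong_sets by blast
    then have "emeasure (M U) B = emeasure (restrict_space \<mu> U) (p -` B \<inter> space (restrict_space \<mu> U))"
      unfolding M_def using B by (intro emeasure_distr)
    also have "p -` B \<inter> space (restrict_space \<mu> U) = {a \<in> U. p a \<in> B}"
      using U' s\<mu>(2) by (auto simp: space_restrict_space)
    also have "emeasure (restrict_space \<mu> U) {a \<in> U. p a \<in> B} = emeasure \<mu> {a \<in> U. p a \<in> B}"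
      using U' s\<mu> by (intro emeasure_restrict_space) (auto simp: Int_absorb2)
    finally show ?thesis .
  qed
  have inner: "emeasure (M U) B \<le> (SUP K \<in> {K \<in> sets (borel_of Y). K \<subseteq> B \<and> compactin Y K}. emeasure (M U) K)"
    if U: "sheet X Y p U" and B: "B \<in> sets (borel_of Y)" "B \<subseteq> p ` U" for U B
  proof -
    let ?A = "{a \<in> U. p a \<in> B}"
    have "emeasure (M U) B = (SUP K \<in> {K \<in> sets \<mu>. K \<subseteq> ?A \<and> compactin X K}. emeasure \<mu> K)"
      using \<mu> sheet_borel_preimage[OF U B(1)] B s\<mu> by (auto simp: M[OF U] radon_measure_iff)
    also have "\<dots> \<le> (SUP K \<in> {K \<in> sets (borel_of Y). K \<subseteq> B \<and> compactin Y K}. emeasure (M U) K)"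
    proof (rule SUP_least)
      fix K assume "K \<in> {K \<in> sets \<mu>. K \<subseteq> ?A \<and> compactin X K}"
      then have K: "K \<in> sets (borel_of X)" "K \<subseteq> U" "p ` K \<subseteq> B" "compactin X K"
        using s\<mu> by auto
      have "{a \<in> U. p a \<in> p ` K} = K"
        using K(2) sheet_inj[OF U] by (auto simp: inj_on_def subset_iff)
      then have "emeasure \<mu> K = emeasure (M U) (p ` K)"
        using M[OF U sheet_borel_image[OF U K(1,2)]] by simp
      also have "\<dots> \<le> (SUP K \<in> {K \<in> sets (borel_of Y). K \<subseteq> B \<and> compactin Y K}. emeasure (M U) K)"
        using sheet_borel_image[OF U K(1,2)] sheet_compact_image[OF U K(4,2)] K(3)
        by (intro SUP_upper) auto
      finally show "emeasure \<mu> K \<le> (SUP K \<in> {K \<in> sets (borel_of Y). K \<subseteq> B \<and> compactin Y K}. emeasure (M U) K)" .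
    qed
    finally show "emeasure (M U) B \<le> (SUP K \<in> {K \<in> sets (borel_of Y). K \<subseteq> B \<and> compactin Y K}. emeasure (M U) K)" .
  qed
  \<comment> \<open>Local agreement is upgraded to agreement on the whole overlap through inner
    regularity of \<open>M U\<close>, which is why \<open>inner\<close> comes first.\<close>
  have le: "emeasure (M U) B \<le> emeasure (M V) B"
    if U: "sheet X Y p U" and V: "sheet X Y p V" and B: "B \<in> sets (borel_of Y)" "B \<subseteq> p ` U \<inter> p ` V" for U V B
  proof -
    define \<W> where "\<W> = {W. openin Y W \<and>
      (\<forall>B \<in> sets (borel_of Y). B \<subseteq> W \<longrightarrow> emeasure (M U) B = emeasure (M V) B)}"
    show ?thesis
    proof (rule emeasure_le_of_local_le)
      show "sets (M U) = sets (borel_of Y)" "sets (M V) = sets (borel_of Y)"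
        by (simp_all add: M_def)
      then show "emeasure (M U) B \<le> (SUP K \<in> {K \<in> sets (M U). K \<subseteq> B \<and> compactin Y K}. emeasure (M U) K)"
        using inner[OF U] B by simp
      show "B \<in> sets (borel_of Y)"
        by fact
      show "B \<subseteq> \<Union>\<W>"
      proof
        fix q assume "q \<in> B"
        then have "q \<in> p ` U \<inter> p ` V"
          using B by blast
        from compat[OF U V this] obtain W where W: "openin Y W" "q \<in> W"
            "\<forall>B \<in> sets (borel_of Y). B \<subseteq> W \<longrightarrow> emeasure \<mu> {a \<in> U. p a \<in> B} = emeasure \<mu> {a \<in> V. p a \<in> B}"
          by blast
        then have "W \<in> \<W>"
          by (simp add: \<W>_def M[OF U] M[OF V])
        with W(2) show "q \<in> \<Union>\<W>"
          by blast
      qed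
      show "openin Y W" if "W \<in> \<W>" for W
        using that by (simp add: \<W>_def)
      show "emeasure (M U) C \<le> emeasure (M V) C" if "W \<in> \<W>" "C \<in> sets (borel_of Y)" "C \<subseteq> B \<inter> W" for W C
        using that by (simp add: \<W>_def)
    qed
  qed
  interpret compatible_measures Y "{U. sheet X Y p U}" M "\<lambda>U. p ` U"
  proof
    show "topspace Y \<subseteq> (\<Union>U\<in>{U. sheet X Y p U}. p ` U)"
    proof
      fix q assume "q \<in> topspace Y"
      then obtain a where a: "a \<in> topspace X" "q = p a"
        using surj by auto
      then obtain U where "sheet X Y p U" "a \<in> U"
        using local_homeomorphism_sheet[OF p] by metis
      then show "q \<in> (\<Union>U\<in>{U. sheet X Y p U}. p ` U)"
        using a by auto
    qed
  next
    fix U assume "U \<in> {U. sheet X Y p U}"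
    then show "sets (M U) = sets (borel_of Y)" "openin Y (p ` U)"
      by (simp_all add: M_def sheet_image_open)
  next
    fix U V B assume "U \<in> {U. sheet X Y p U}" "V \<in> {U. sheet X Y p U}" "B \<in> sets (borel_of Y)" "B \<subseteq> p ` U \<inter> p ` V"
    then show "emeasure (M U) B = emeasure (M V) B"
      using le[of U V B] le[of V U B] by (auto intro!: antisym)
  next
    fix U q assume "U \<in> {U. sheet X Y p U}" and q: "q \<in> p ` U"
    then obtain a where U: "sheet X Y p U" and a: "a \<in> U" "q = p a"
      by auto
    have "a \<in> topspace X"
      using a openin_subset[OF sheet_open[OF U]] by auto
    then obtain W where W: "openin X W" "a \<in> W" "emeasure \<mu> W < \<infinity>"
      using \<mu> by (auto simp: radon_measure_iff)
    have V: "openin Y (p ` (W \<inter> U))"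
      using sheet_openin_image[OF U] W(1) sheet_open[OF U] by auto
    have "{b \<in> U. p b \<in> p ` (W \<inter> U)} \<subseteq> W"
      using sheet_inj[OF U] by (auto simp: inj_on_def)
    then have "emeasure (M U) (p ` (W \<inter> U)) \<le> emeasure \<mu> W"
      using V W(1) s\<mu> by (auto simp: M[OF U] openin_borel_of intro!: emeasure_mono)
    then show "\<exists>V. openin Y V \<and> q \<in> V \<and> V \<subseteq> p ` U \<and> emeasure (M U) V < \<infinity>"
      using V W a by (intro exI[of _ "p ` (W \<inter> U)"]) auto
  next
    fix U B assume "U \<in> {U. sheet X Y p U}" and B: "B \<in> sets (borel_of Y)" "B \<subseteq> p ` U"
    then have U: "sheet X Y p U"
      by simp
    show "emeasure (M U) B \<le> (SUP K \<in> {K \<in> sets (borel_of Y). K \<subseteq> B \<and> compactin Y K}. emeasure (M U) K)"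
      by (rule inner[OF U B])
  qed
  show thesis
  proof
    show "radon_measure Y glued"
      by (rule radon_measure_glued)
    fix U B assume "sheet X Y p U" "B \<in> sets (borel_of Y)" "B \<subseteq> p ` U"
    then show "emeasure glued B = emeasure \<mu> {a \<in> U. p a \<in> B}"
      by (simp add: emeasure_glued_chart M)
  qed
qed

section \<open>Locally trivial groupoids\<close>

locale lt_groupoid =
  fixes G :: "'a top_groupoid"
  assumes lc: "locally_compact_groupoid G" and lt: "locally_trivial G"
begin

abbreviation mult (infixl "\<cdot>" 70) where "a \<cdot> b \<equiv> gmult G a b"
abbreviation r where "r \<equiv> grng G"
abbreviation s where "s \<equiv> gsrc G"
abbreviation inv_arrow where "inv_arrow \<equiv> ginv G"

lemma tg: "topological_groupoid G"
  using lc by (simp add: locally_compact_groupoid_def)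

lemma gd: "groupoid G"
  using tg by (simp add: topological_groupoid_def)

lemma Hausdorff_units: "Hausdorff_space (unit_top G)"
  using lc by (simp add: locally_compact_groupoid_def)

lemma units_arrows: "units G \<subseteq> arrows G"
  using gd by (simp add: groupoid_def)

lemma unit_props:
  assumes "u \<in> units G"
  shows "u \<in> arrows G" "r u = u" "s u = u"
  using gd assms by (auto simp: groupoid_def)

lemma arrow_props:
  assumes "a \<in> arrows G"
  shows "r a \<in> units G" "s a \<in> units G" "r a \<cdot> a = a" "a \<cdot> s a = a"
  using gd assms by (auto simp: groupoid_def)

lemma inv_props:
  assumes "a \<in> arrows G"
  shows "inv_arrow a \<in> arrows G" "r (inv_arrow a) = s a" "s (inv_arrow a) = r a"
    "inv_arrow a \<cdot> a = s a" "a \<cdot> inv_arrow a = r a"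
  using gd assms by (auto simp: groupoid_def)

lemma mult_props:
  assumes "a \<in> arrows G" "b \<in> arrows G" "s a = r b"
  shows "a \<cdot> b \<in> arrows G" "r (a \<cdot> b) = r a" "s (a \<cdot> b) = s b"
  using gd assms by (auto simp: groupoid_def composable_def)

lemma mult_assoc:
  assumes "a \<in> arrows G" "b \<in> arrows G" "c \<in> arrows G" "s a = r b" "s b = r c"
  shows "a \<cdot> b \<cdot> c = a \<cdot> (b \<cdot> c)"
  using gd assms by (auto simp: groupoid_def composable_def)

lemma inv_mult_cancel:
  assumes "a \<in> arrows G" "b \<in> arrows G" "s a = r b"
  shows "inv_arrow a \<cdot> (a \<cdot> b) = b"
  using assms by (simp add: inv_props arrow_props flip: mult_assoc)

lemma mult_inv_cancel:
  assumes "a \<in> arrows G" "b \<in> arrows G" "r a = r b"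
  shows "a \<cdot> (inv_arrow a \<cdot> b) = b"
  using assms by (simp add: inv_props arrow_props flip: mult_assoc)

lemma mult_right_inv_cancel:
  assumes "a \<in> arrows G" "b \<in> arrows G" "s a = r b"
  shows "a \<cdot> b \<cdot> inv_arrow b = a"
  using assms arrow_props(4)[of a] by (simp add: inv_props mult_assoc)

lemma mult_right_cancel:
  assumes "a \<in> arrows G" "b \<in> arrows G" "c \<in> arrows G" "s a = r c" "s b = r c"
    and "a \<cdot> c = b \<cdot> c"
  shows "a = b"
  using assms mult_right_inv_cancel by metis

lemma mult_left_cancel:
  assumes "a \<in> arrows G" "b \<in> arrows G" "c \<in> arrows G" "s c = r a" "s c = r b"
    and "c \<cdot> a = c \<cdot> b"
  shows "a = b"
  using assms inv_mult_cancel by metis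

lemma topspace_gtop: "topspace (gtop G) = arrows G"
  by (simp add: arrows_def)

lemma topspace_unit_top: "topspace (unit_top G) = units G"
  using units_arrows by (auto simp: unit_top_def topspace_gtop)

lemma rfib_iff: "a \<in> rfib G u \<longleftrightarrow> a \<in> arrows G \<and> r a = u"
  by (auto simp: rfib_def)

lemma isotropy_iff: "a \<in> isotropy G u \<longleftrightarrow> a \<in> arrows G \<and> r a = u \<and> s a = u"
  by (auto simp: isotropy_def)

lemma topspace_rfib_top: "topspace (rfib_top G u) = rfib G u"
  by (auto simp: rfib_top_def topspace_gtop rfib_iff)

lemma src_continuous: "continuous_map (gtop G) (unit_top G) s"
  and rng_continuous: "continuous_map (gtop G) (unit_top G) r"
  and inv_continuous: "continuous_map (gtop G) (gtop G) inv_arrow"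
  using tg by (auto simp: topological_groupoid_def)

text \<open>Continuity of multiplication in the form needed below: composability has to hold only
  along the two given maps.\<close>

lemma mult_continuous:
  assumes "continuous_map Z (gtop G) f" "continuous_map Z (gtop G) g"
    and "\<And>z. z \<in> topspace Z \<Longrightarrow> s (f z) = r (g z)"
  shows "continuous_map Z (gtop G) (\<lambda>z. f z \<cdot> g z)"
proof -
  have "continuous_map Z (subtopology (prod_topology (gtop G) (gtop G)) (composable G)) (\<lambda>z. (f z, g z))"
    unfolding continuous_map_in_subtopology
    using assms continuous_map_funspace[OF assms(1)] continuous_map_funspace[OF assms(2)]
    by (auto simp: continuous_map_pairedI composable_def topspace_gtop[symmetric] Pi_iff)
  moreover have "continuous_map (subtopology (prod_topology (gtop G) (gtop G)) (composable G)) (gtop G)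
       (\<lambda>(a, b). a \<cdot> b)"
    using tg by (simp add: topological_groupoid_def)
  ultimately show ?thesis
    using continuous_map_compose by (fastforce simp: o_def)
qed

lemma continuous_map_rfib_topD:
  "continuous_map Z (rfib_top G u) f \<Longrightarrow> continuous_map Z (gtop G) f"
  by (simp add: rfib_top_def continuous_map_in_subtopology)

lemma closedin_rfib:
  assumes "u \<in> units G"
  shows "closedin (gtop G) (rfib G u)"
proof -
  have "closedin (unit_top G) {u}"
    using assms Hausdorff_units by (simp add: closedin_Hausdorff_singleton topspace_unit_top)
  from closedin_continuous_map_preimage[OF rng_continuous this] show ?thesis
    by (simp add: rfib_def topspace_gtop)
qed

lemma src_local_homeomorphism:
  "u \<in> units G \<Longrightarrow> local_homeomorphism (rfib_top G u) (unit_top G) s"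
  and src_surj: "u \<in> units G \<Longrightarrow> s ` rfib G u = units G"
  using lt by (auto simp: locally_trivial_def)

lemma transitive:
  assumes "u \<in> units G" "v \<in> units G"
  obtains a where "a \<in> arrows G" "r a = u" "s a = v"
proof -
  have "v \<in> s ` rfib G u"
    using src_surj[OF assms(1)] assms(2) by simp
  then show thesis
    using that by (auto simp: rfib_iff)
qed

section \<open>Sheets, local sections and separation of arrows\<close>

abbreviation sheet_at where "sheet_at u \<equiv> sheet (rfib_top G u) (unit_top G) s"

lemma obtain_sheet:
  assumes "a \<in> arrows G"
  obtains U where "sheet_at (r a) U" "a \<in> U"
  using local_homeomorphism_sheet[OF src_local_homeomorphism[OF arrow_props(1)[OF assms]], of a] assms
  by (auto simp: topspace_rfib_top rfib_iff)

lemma sheet_at_subset: "sheet_at u U \<Longrightarrow> U \<subseteq> rfib G u"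
  using openin_subset[OF sheet_open] by (fastforce simp: topspace_rfib_top)

lemma sheet_at_arrow:
  assumes "sheet_at u U" "a \<in> U"
  shows "a \<in> arrows G" "r a = u"
  using sheet_at_subset[OF assms(1)] assms(2) by (auto simp: rfib_iff)

text \<open>Inverts \<open>s\<close> on a sheet through \<open>a\<close>. The resulting arrows have
  a fixed range and a moving source; their inverses give sections of \<open>r\<close>.\<close>

lemma local_section:
  assumes "a \<in> arrows G"
  obtains V \<sigma> where "openin (unit_top G) V" "s a \<in> V" "continuous_map (subtopology (unit_top G) V) (gtop G) \<sigma>"
    "\<And>v. v \<in> V \<Longrightarrow> \<sigma> v \<in> arrows G" "\<And>v. v \<in> V \<Longrightarrow> r (\<sigma> v) = r a" "\<And>v. v \<in> V \<Longrightarrow> s (\<sigma> v) = v" "\<sigma> (s a) = a"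
proof -
  obtain U where U: "sheet_at (r a) U" "a \<in> U"
    using obtain_sheet[OF assms] .
  show thesis
  proof
    let ?\<sigma> = "inv_into U s"
    show "openin (unit_top G) (s ` U)" "s a \<in> s ` U" "?\<sigma> (s a) = a"
      using sheet_image_open[OF U(1)] U(2) inv_into_f_f[OF sheet_inj[OF U(1)]] by auto
    show "continuous_map (subtopology (unit_top G) (s ` U)) (gtop G) ?\<sigma>"
      using continuous_map_into_fulltopology[OF sheet_inverse_continuous[OF U(1)]] continuous_map_rfib_topD by blast
    fix v assume v: "v \<in> s ` U"
    then have "?\<sigma> v \<in> U"
      by (rule inv_into_into)
    then show "?\<sigma> v \<in> arrows G" "r (?\<sigma> v) = r a"
      using sheet_at_arrow[OF U(1)] by auto
    show "s (?\<sigma> v) = v"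
      using v by (rule f_inv_into_f)
  qed
qed

text \<open>A sheet through \<open>a\<close> is the trace of an open \<open>W\<close> on the range
  fibre, and \<open>s\<close> is injective on it, so \<open>W\<close> contains no second arrow with
  the same range and source.\<close>

lemma hom_set_discrete:
  assumes "a \<in> arrows G"
  obtains W where "openin (gtop G) W" "a \<in> W" "\<forall>b \<in> W. r b = r a \<and> s b = s a \<longrightarrow> b = a"
proof -
  obtain U where U: "sheet_at (r a) U" "a \<in> U"
    using obtain_sheet[OF assms] .
  then obtain W where W: "openin (gtop G) W" "U = W \<inter> rfib G (r a)"
    using sheet_open[OF U(1)] by (auto simp: rfib_top_def openin_subtopology)
  show thesis
  proof
    show "openin (gtop G) W" "a \<in> W"
      using W U(2) by auto
    show "\<forall>b \<in> W. r b = r a \<and> s b = s a \<longrightarrow> b = a"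
    proof (intro ballI impI)
      fix b assume b: "b \<in> W" "r b = r a \<and> s b = s a"
      then have "b \<in> U"
        using W openin_subset[OF W(1)] by (auto simp: rfib_iff topspace_gtop)
      then show "b = a"
        using sheet_inj[OF U(1)] U(2) b(2) by (auto simp: inj_on_def)
    qed
  qed
qed

text \<open>Two distinct arrows \<open>a\<close>, \<open>b\<close> with the same range and source are separated by the continuous map
  \<open>c \<mapsto> \<tau> (r c) c \<sigma> (s c)\<^sup>-\<^sup>1\<close> into the discrete isotropy group, with
  local sections \<open>\<sigma>\<close> through \<open>a\<close> and \<open>\<tau>\<close> through a unit.\<close>

lemma Hausdorff_arrows: "Hausdorff_space (gtop G)"
  unfolding Hausdorff_space_def
proof (intro allI impI)
  fix a b assume "a \<in> topspace (gtop G) \<and> b \<in> topspace (gtop G) \<and> a \<noteq> b"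
  then have ab: "a \<in> arrows G" "b \<in> arrows G" "a \<noteq> b"
    by (auto simp: topspace_gtop)
  let ?D = "\<lambda>A B. openin (gtop G) A \<and> openin (gtop G) B \<and> a \<in> A \<and> b \<in> B \<and> disjnt A B"
  have sep: "\<exists>A B. ?D A B" if f: "continuous_map (gtop G) (unit_top G) f" "f a \<noteq> f b" for f
  proof -
    have "f a \<in> topspace (unit_top G)" "f b \<in> topspace (unit_top G)"
      using continuous_map_funspace[OF f(1)] ab by (auto simp: topspace_gtop Pi_iff)
    then obtain A B where AB: "openin (unit_top G) A" "openin (unit_top G) B" "f a \<in> A" "f b \<in> B" "disjnt A B"
      using Hausdorff_units f(2) unfolding Hausdorff_space_def by blast
    then show ?thesis
      using openin_continuous_map_preimage[OF f(1) AB(1)] openin_continuous_map_preimage[OF f(1) AB(2)] ab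
      by (intro exI[of _ "{c \<in> topspace (gtop G). f c \<in> A}"] exI[of _ "{c \<in> topspace (gtop G). f c \<in> B}"])
        (auto simp: topspace_gtop disjnt_def)
  qed
  consider "r a \<noteq> r b" | "s a \<noteq> s b" | "r a = r b" "s a = s b"
    by blast
  then show "\<exists>A B. ?D A B"
  proof cases
    case 3
    obtain V \<sigma> where V: "openin (unit_top G) V" "s a \<in> V" "continuous_map (subtopology (unit_top G) V) (gtop G) \<sigma>"
      and \<sigma>: "\<And>v. v \<in> V \<Longrightarrow> \<sigma> v \<in> arrows G" "\<And>v. v \<in> V \<Longrightarrow> r (\<sigma> v) = r a" "\<And>v. v \<in> V \<Longrightarrow> s (\<sigma> v) = v" "\<sigma> (s a) = a"
      using local_section[OF ab(1)] by metis
    have u: "r a \<in> arrows G" "s (r a) = r a" "r (r a) = r a"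
      using unit_props arrow_props(1)[OF ab(1)] by auto
    obtain W \<tau> where W: "openin (unit_top G) W" "r a \<in> W" "continuous_map (subtopology (unit_top G) W) (gtop G) \<tau>"
      and \<tau>: "\<And>v. v \<in> W \<Longrightarrow> \<tau> v \<in> arrows G" "\<And>v. v \<in> W \<Longrightarrow> r (\<tau> v) = r a" "\<And>v. v \<in> W \<Longrightarrow> s (\<tau> v) = v" "\<tau> (r a) = r a"
      using local_section[OF u(1)] u by metis
    define Z where "Z = {c \<in> arrows G. r c \<in> W} \<inter> {c \<in> arrows G. s c \<in> V}"
    define \<phi> where "\<phi> c = \<tau> (r c) \<cdot> c \<cdot> inv_arrow (\<sigma> (s c))" for c
    have Z: "openin (gtop G) Z"
      using openin_continuous_map_preimage[OF rng_continuous W(1)] openin_continuous_map_preimage[OF src_continuous V(1)]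
      by (simp add: Z_def topspace_gtop openin_Int)
    have Zt: "topspace (subtopology (gtop G) Z) = Z"
      using openin_subset[OF Z] by auto
    have ZD: "c \<in> arrows G" "r c \<in> W" "s c \<in> V" if "c \<in> Z" for c
      using that by (auto simp: Z_def)
    have "continuous_map (subtopology (gtop G) Z) (subtopology (unit_top G) W) r"
      using rng_continuous by (auto simp: continuous_map_in_subtopology continuous_map_from_subtopology Z_def)
    then have c1: "continuous_map (subtopology (gtop G) Z) (gtop G) (\<lambda>c. \<tau> (r c))"
      using continuous_map_compose[OF _ W(3)] by (auto simp: o_def)
    have "continuous_map (subtopology (gtop G) Z) (subtopology (unit_top G) V) s"
      using src_continuous by (auto simp: continuous_map_in_subtopology continuous_map_from_subtopology Z_def)
    then have "continuous_map (subtopology (gtop G) Z) (gtop G) (\<lambda>c. \<sigma> (s c))"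
      using continuous_map_compose[OF _ V(3)] by (auto simp: o_def)
    then have c2: "continuous_map (subtopology (gtop G) Z) (gtop G) (\<lambda>c. inv_arrow (\<sigma> (s c)))"
      using continuous_map_compose[OF _ inv_continuous] by (auto simp: o_def)
    have c3: "continuous_map (subtopology (gtop G) Z) (gtop G) (\<lambda>c. c)"
      using continuous_map_from_subtopology[OF continuous_map_id] by (simp add: id_def)
    have \<phi>: "continuous_map (subtopology (gtop G) Z) (gtop G) \<phi>"
      unfolding \<phi>_def
      by (intro mult_continuous c1 c2 c3) (use ZD \<tau> \<sigma> in \<open>auto simp: Zt inv_props mult_props\<close>)
    have \<phi>_iso: "r (\<phi> c) = r a" "s (\<phi> c) = r a" if "c \<in> Z" for c
      using ZD[OF that] \<tau> \<sigma> by (simp_all add: \<phi>_def inv_props mult_props)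
    \<comment> \<open>All values of \<open>\<phi>\<close> have range and source \<open>r a\<close>,
      and such arrows are isolated among one another. Therefore the fibres of the continuous map
      \<open>\<phi>\<close> are open.\<close>
    have fib: "openin (gtop G) {c \<in> Z. \<phi> c = \<phi> d}" if d: "d \<in> Z" for d
    proof -
      have \<phi>d: "\<phi> d \<in> arrows G"
        using ZD[OF d] \<tau> \<sigma> by (simp add: \<phi>_def inv_props mult_props)
      obtain N where N: "openin (gtop G) N" "\<phi> d \<in> N"
        "\<forall>b \<in> N. r b = r (\<phi> d) \<and> s b = s (\<phi> d) \<longrightarrow> b = \<phi> d"
        by (rule hom_set_discrete[OF \<phi>d])
      have "{c \<in> Z. \<phi> c = \<phi> d} = {c \<in> Z. \<phi> c \<in> N}"
      proof (intro Collect_cong conj_cong refl iffI)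
        fix c assume c: "c \<in> Z"
        show "\<phi> c \<in> N" if "\<phi> c = \<phi> d"
          using N(2) that by simp
        show "\<phi> c = \<phi> d" if "\<phi> c \<in> N"
          using N(3)[rule_format, OF that] by (simp only: \<phi>_iso c d)
      qed
      moreover have "openin (subtopology (gtop G) Z) {c \<in> Z. \<phi> c \<in> N}"
        using openin_continuous_map_preimage[OF \<phi> N(1)] by (simp only: Zt)
      ultimately show ?thesis
        using openin_open_subtopology[OF Z] by auto
    qed
    have Zab: "a \<in> Z" "b \<in> Z"
      using ab V(2) W(2) 3 by (auto simp: Z_def)
    have "\<phi> a \<noteq> \<phi> b"
    proof
      assume eq: "\<phi> a = \<phi> b"
      have "\<phi> a = a \<cdot> inv_arrow a" "\<phi> b = b \<cdot> inv_arrow a"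
        using 3 ab \<tau>(4) \<sigma>(4) arrow_props(3)[OF ab(1)] arrow_props(3)[OF ab(2)] by (simp_all add: \<phi>_def)
      with eq have "a \<cdot> inv_arrow a = b \<cdot> inv_arrow a"
        by simp
      then have "a = b"
        by (intro mult_right_cancel[of a b "inv_arrow a"]) (simp_all only: ab inv_props 3)
      then show False
        using ab by simp
    qed
    then show ?thesis
      using fib[OF Zab(1)] fib[OF Zab(2)] Zab
      by (intro exI[of _ "{c \<in> Z. \<phi> c = \<phi> a}"] exI[of _ "{c \<in> Z. \<phi> c = \<phi> b}"]) (auto simp: disjnt_def)
  qed (use sep[OF rng_continuous] sep[OF src_continuous] in auto)
qed

lemma locally_compact_arrows: "locally_compact_space (gtop G)"
  using lc unfolding locally_compact_groupoid_def locally_compact_space_def by (metis arrows_def)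

lemma Hausdorff_rfib: "Hausdorff_space (rfib_top G u)"
  by (simp add: rfib_top_def Hausdorff_arrows Hausdorff_space_subtopology)

section \<open>Left translation between range fibres\<close>

lemma mult_rfib:
  assumes "c \<in> arrows G" "a \<in> rfib G (s c)"
  shows "c \<cdot> a \<in> rfib G (r c)" "s (c \<cdot> a) = s a"
  using assms mult_props by (auto simp: rfib_iff)

lemma left_mult_continuous:
  assumes "c \<in> arrows G"
  shows "continuous_map (rfib_top G (s c)) (rfib_top G (r c)) (\<lambda>a. c \<cdot> a)"
proof -
  have "continuous_map (rfib_top G (s c)) (gtop G) (\<lambda>a. c \<cdot> a)"
  proof (rule mult_continuous)
    show "continuous_map (rfib_top G (s c)) (gtop G) (\<lambda>a. c)"
      using assms by (simp add: topspace_gtop)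
    show "continuous_map (rfib_top G (s c)) (gtop G) (\<lambda>a. a)"
      using continuous_map_from_subtopology[OF continuous_map_id] by (simp add: id_def rfib_top_def)
  qed (auto simp: topspace_rfib_top rfib_iff)
  then show ?thesis
    using mult_rfib[OF assms] by (auto simp: rfib_top_def[of G "r c"] continuous_map_in_subtopology topspace_rfib_top)
qed

lemma left_mult_homeomorphic_maps:
  assumes "c \<in> arrows G"
  shows "homeomorphic_maps (rfib_top G (s c)) (rfib_top G (r c)) (\<lambda>a. c \<cdot> a) (\<lambda>a. inv_arrow c \<cdot> a)"
  using left_mult_continuous[OF assms] left_mult_continuous[OF inv_props(1)[OF assms]] assms
  by (auto simp: homeomorphic_maps_def inv_props topspace_rfib_top rfib_iff inv_mult_cancel mult_inv_cancel)

lemma left_mult_homeomorphic: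
  assumes "c \<in> arrows G"
  shows "homeomorphic_map (rfib_top G (s c)) (rfib_top G (r c)) (\<lambda>a. c \<cdot> a)"
  using left_mult_homeomorphic_maps[OF assms] homeomorphic_map_maps by blast

lemma left_mult_image_eq:
  assumes "c \<in> arrows G" "B \<subseteq> rfib G (s c)"
  shows "(\<lambda>a. c \<cdot> a) ` B = {a \<in> rfib G (r c). inv_arrow c \<cdot> a \<in> B}"
proof (intro equalityI subsetI)
  fix a assume "a \<in> (\<lambda>a. c \<cdot> a) ` B"
  then show "a \<in> {a \<in> rfib G (r c). inv_arrow c \<cdot> a \<in> B}"
    using assms mult_rfib[OF assms(1)] by (auto simp: inv_mult_cancel rfib_iff subset_iff)
next
  fix a assume "a \<in> {a \<in> rfib G (r c). inv_arrow c \<cdot> a \<in> B}"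
  then show "a \<in> (\<lambda>a. c \<cdot> a) ` B"
    using assms mult_inv_cancel[OF assms(1), of a] by (force simp: rfib_iff)
qed

text \<open>The image is a preimage under left multiplication by the inverse arrow, which is
  continuous.\<close>

lemma left_mult_borel:
  assumes "c \<in> arrows G" "B \<in> sets (borel_of (rfib_top G (s c)))"
  shows "(\<lambda>a. c \<cdot> a) ` B \<in> sets (borel_of (rfib_top G (r c)))"
proof -
  have "B \<subseteq> rfib G (s c)"
    using sets.sets_into_space[OF assms(2)] by (simp add: topspace_rfib_top)
  from left_mult_image_eq[OF assms(1) this]
  have "(\<lambda>a. c \<cdot> a) ` B = (\<lambda>a. inv_arrow c \<cdot> a) -` B \<inter> space (borel_of (rfib_top G (r c)))"
    by (auto simp: topspace_rfib_top)
  moreover have "(\<lambda>a. inv_arrow c \<cdot> a) \<in> measurable (borel_of (rfib_top G (r c))) (borel_of (rfib_top G (s c)))"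
    using measurable_borel_of[OF left_mult_continuous[OF inv_props(1)[OF assms(1)]]] assms(1)
    by (simp add: inv_props)
  ultimately show ?thesis
    using measurable_sets assms(2) by metis
qed

lemma left_mult_vimage_image:
  assumes c: "c \<in> arrows G" and B: "B \<subseteq> rfib G (s c)"
  shows "{a \<in> rfib G (s c). c \<cdot> a \<in> (\<lambda>a. c \<cdot> a) ` B} = B"
proof -
  have "a \<in> B" if "a \<in> rfib G (s c)" "c \<cdot> a = c \<cdot> b" "b \<in> B" for a b
    using that mult_left_cancel[of a b c] B c by (auto simp: rfib_iff subset_iff)
  then show ?thesis
    using B by auto
qed

end

section \<open>Invariant measures on \<open>G\<^sup>x\<close> and measures on the unit space\<close>

lemma fully_supported_iff:
  "fully_supported X M \<longleftrightarrow> (\<forall>U. openin X U \<and> U \<noteq> {} \<longrightarrow> emeasure M U \<noteq> 0)"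
proof -
  have "p \<in> topspace X" if "openin X U" "p \<in> U" for p U
    using that openin_subset by blast
  then show ?thesis
    unfolding fully_supported_def measure_support_def by blast
qed

context lt_groupoid
begin

text \<open>Left multiplication keeps sources, so on the translated set \<open>s\<close> is the
  homeomorphism \<open>s\<close> on \<open>U\<close> preceded by translation back by the inverse of
  \<open>c\<close>.\<close>

lemma sheet_at_left_mult:
  assumes c: "c \<in> arrows G" and U: "sheet_at (s c) U"
  shows "sheet_at (r c) ((\<lambda>a. c \<cdot> a) ` U)"
proof -
  have Us: "U \<subseteq> rfib G (s c)"
    using sheet_at_subset[OF U] .
  let ?V = "(\<lambda>a. c \<cdot> a) ` U"
  have Vs: "?V \<subseteq> rfib G (r c)"
    using mult_rfib(1)[OF c] Us by auto
  have sV: "s ` ?V = s ` U"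
    using mult_rfib(2)[OF c] Us by (force simp: image_image intro!: image_cong)
  have V: "openin (rfib_top G (r c)) ?V"
    using homeomorphic_imp_open_map[OF left_mult_homeomorphic[OF c]] sheet_open[OF U] by (simp add: open_map_def)
  have VU: "(\<lambda>a. inv_arrow c \<cdot> a) ` ?V = U"
    using Us c by (force simp: image_image rfib_iff inv_mult_cancel)
  have "homeomorphic_map (rfib_top G (r c)) (rfib_top G (s c)) (\<lambda>a. inv_arrow c \<cdot> a)"
    using left_mult_homeomorphic[OF inv_props(1)[OF c]] c by (simp add: inv_props)
  then have "homeomorphic_map (subtopology (rfib_top G (r c)) ?V) (subtopology (rfib_top G (s c)) U) (\<lambda>a. inv_arrow c \<cdot> a)"
    by (rule homeomorphic_map_subtopologies)
      (use Us Vs VU in \<open>simp add: topspace_rfib_top Int_absorb1\<close>)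
  then have "homeomorphic_map (subtopology (rfib_top G (r c)) ?V) (subtopology (unit_top G) (s ` U)) (s \<circ> (\<lambda>a. inv_arrow c \<cdot> a))"
    using sheet_homeomorphic[OF U] by (rule homeomorphic_map_compose)
  then have "homeomorphic_map (subtopology (rfib_top G (r c)) ?V) (subtopology (unit_top G) (s ` U)) s"
  proof (rule homeomorphic_map_eq)
    fix a assume "a \<in> topspace (subtopology (rfib_top G (r c)) ?V)"
    then have "a \<in> arrows G" "r a = r c"
      by (auto simp: topspace_rfib_top rfib_iff)
    then show "(s \<circ> (\<lambda>a. inv_arrow c \<cdot> a)) a = s a"
      using c by (simp add: mult_props inv_props)
  qed
  then show ?thesis
    using V sheet_image_open[OF U] by (simp add: sheet_def sV)
qed

text \<open>The lifted measure sees a subset of a sheet only through its sources, and left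
  multiplication by isotropy elements preserves sources.\<close>

lemma invariant_measure_of_unit_measure:
  assumes x: "x \<in> units G"
    and \<nu>: "radon_measure (unit_top G) \<nu>" "fully_supported (unit_top G) \<nu>"
  obtains \<mu> where "radon_measure (rfib_top G x) \<mu>" "fully_supported (rfib_top G x) \<mu>" "isotropy_invariant G x \<mu>"
proof -
  obtain \<mu> where \<mu>: "radon_measure (rfib_top G x) \<mu>"
    and \<mu>\<nu>: "\<And>U B. sheet_at x U \<Longrightarrow> B \<in> sets (borel_of (rfib_top G x)) \<Longrightarrow> B \<subseteq> U \<Longrightarrow> emeasure \<mu> B = emeasure \<nu> (s ` B)"
    using radon_measure_pullback[OF src_local_homeomorphism[OF x] \<nu>(1)] by metis
  have s\<mu>: "sets \<mu> = sets (borel_of (rfib_top G x))" "space \<mu> = rfib G x"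
    using \<mu> by (simp_all add: radon_measure_sets radon_measure_space topspace_rfib_top)
  show thesis
  proof
    show "radon_measure (rfib_top G x) \<mu>"
      by fact
    show "fully_supported (rfib_top G x) \<mu>"
      unfolding fully_supported_iff
    proof (intro allI impI)
      fix W assume "openin (rfib_top G x) W \<and> W \<noteq> {}"
      then obtain a where W: "openin (rfib_top G x) W" "a \<in> W"
        by blast
      then have "a \<in> arrows G" "r a = x"
        using openin_subset[OF W(1)] by (auto simp: topspace_rfib_top rfib_iff)
      then obtain U where U: "sheet_at x U" "a \<in> U"
        using obtain_sheet by metis
      have UW: "openin (rfib_top G x) (W \<inter> U)"
        using W U sheet_open by blast
      then have "openin (unit_top G) (s ` (W \<inter> U))"
        using sheet_openin_image[OF U(1)] by blast
      then have "emeasure \<nu> (s ` (W \<inter> U)) \<noteq> 0"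
        using \<nu>(2) W U by (auto simp: fully_supported_iff)
      then have "emeasure \<mu> (W \<inter> U) \<noteq> 0"
        using \<mu>\<nu>[OF U(1)] openin_borel_of[OF UW] by simp
      moreover have "emeasure \<mu> (W \<inter> U) \<le> emeasure \<mu> W"
        using openin_borel_of[OF W(1)] s\<mu> by (intro emeasure_mono) auto
      ultimately show "emeasure \<mu> W \<noteq> 0"
        by auto
    qed
    show "isotropy_invariant G x \<mu>"
      unfolding isotropy_invariant_def
    proof (intro ballI)
      fix g B assume "g \<in> isotropy G x" and B: "B \<in> sets \<mu>"
      then have g: "g \<in> arrows G" "r g = x" "s g = x"
        by (auto simp: isotropy_iff)
      let ?N = "distr \<mu> (borel_of (rfib_top G x)) (\<lambda>a. g \<cdot> a)"
      have mg: "(\<lambda>a. g \<cdot> a) \<in> measurable \<mu> (borel_of (rfib_top G x))"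
        using measurable_borel_of[OF left_mult_continuous[OF g(1)]] g by (simp add: measurable_cong_sets[OF s\<mu>(1) refl])
      have em: "emeasure ?N A = emeasure \<mu> {a \<in> rfib G x. g \<cdot> a \<in> A}" if "A \<in> sets (borel_of (rfib_top G x))" for A
        using emeasure_distr[OF mg that] by (simp add: s\<mu>(2) vimage_def Int_def conj_commute)
      \<comment> \<open>A general \<open>B\<close> need not lie in one sheet, so invariance is
        proved as an equality of two Radon measures, for which sheets suffice.\<close>
      have "\<mu> = ?N"
      proof (rule radon_measure_eqI_local[OF \<mu>, where \<W> = "{U. sheet_at x U}"])
        have "homeomorphic_map (rfib_top G x) (subtopology (rfib_top G x) (rfib G x)) (\<lambda>a. g \<cdot> a)"
          using left_mult_homeomorphic[OF g(1)] g subtopology_topspace[of "rfib_top G x"] by (simp add: topspace_rfib_top)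
        then show "radon_measure (rfib_top G x) ?N"
          using closedin_topspace[of "rfib_top G x"]
          by (intro radon_measure_distr[OF Hausdorff_rfib \<mu>]) (auto simp: topspace_rfib_top)
        show "topspace (rfib_top G x) \<subseteq> \<Union>{U. sheet_at x U}"
        proof
          fix a assume "a \<in> topspace (rfib_top G x)"
          then have "a \<in> arrows G" "r a = x"
            by (auto simp: topspace_rfib_top rfib_iff)
          then obtain U where "sheet_at x U" "a \<in> U"
            using obtain_sheet by metis
          then show "a \<in> \<Union>{U. sheet_at x U}"
            by blast
        qed
        show "openin (rfib_top G x) U" if "U \<in> {U. sheet_at x U}" for U
          using that sheet_open by blast
        fix U A assume "U \<in> {U. sheet_at x U}" and A: "A \<in> sets (borel_of (rfib_top G x))" "A \<subseteq> U"
        then have U: "sheet_at x U"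
          by simp
        let ?A = "(\<lambda>a. inv_arrow g \<cdot> a) ` A"
        have As: "A \<subseteq> rfib G x"
          using sheet_at_subset[OF U] A by blast
        have ig: "inv_arrow g \<in> arrows G" "r (inv_arrow g) = x" "s (inv_arrow g) = x"
          using g by (simp_all add: inv_props)
        have "{a \<in> rfib G x. g \<cdot> a \<in> A} = ?A"
        proof (intro equalityI subsetI)
          fix a assume "a \<in> {a \<in> rfib G x. g \<cdot> a \<in> A}"
          then show "a \<in> ?A"
            using inv_mult_cancel[OF g(1), of a] g by (force simp: rfib_iff)
        next
          fix a assume "a \<in> ?A"
          then obtain b where b: "b \<in> A" "a = inv_arrow g \<cdot> b"
            by blast
          have b': "b \<in> arrows G" "r b = x"
            using b(1) As by (auto simp: rfib_iff)
          then have "g \<cdot> a = b" "a \<in> rfib G x"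
            using b g ig mult_inv_cancel[OF g(1), of b] by (simp_all add: rfib_iff mult_props)
          then show "a \<in> {a \<in> rfib G x. g \<cdot> a \<in> A}"
            using b by simp
        qed
        moreover have "emeasure \<mu> ?A = emeasure \<nu> (s ` ?A)"
        proof (rule \<mu>\<nu>)
          show "sheet_at x ((\<lambda>a. inv_arrow g \<cdot> a) ` U)"
            using sheet_at_left_mult[OF ig(1)] U ig by simp
          show "?A \<in> sets (borel_of (rfib_top G x))"
            using left_mult_borel[OF ig(1)] A ig by simp
        qed (use A in auto)
        \<comment> \<open>\<open>A\<close> and its translate lie in two sheets over the same set of
          units, hence have the same lifted measure.\<close>
        moreover have "s ` ?A = s ` A"
          unfolding image_image by (rule image_cong[OF refl], rule mult_rfib(2)) (use As ig in auto)
        ultimately show "emeasure \<mu> A = emeasure ?N A"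
          using em[OF A(1)] \<mu>\<nu>[OF U A] by simp
      qed
      moreover have gB: "(\<lambda>a. g \<cdot> a) ` B \<in> sets (borel_of (rfib_top G x))"
        using left_mult_borel[OF g(1)] B g s\<mu> by simp
      moreover have "{a \<in> rfib G x. g \<cdot> a \<in> (\<lambda>a. g \<cdot> a) ` B} = B"
        using left_mult_vimage_image[OF g(1), of B] sets.sets_into_space[OF B] s\<mu> g by simp
      ultimately show "emeasure \<mu> ((\<lambda>a. g \<cdot> a) ` B) = emeasure \<mu> B"
        using em[OF gB] by simp
    qed
  qed
qed

text \<open>Two sheets through arrows \<open>a\<close> and \<open>b\<close> with common source
  differ, near that source, by left multiplication with an isotropy element. Invariance then makes
  the measures induced by the two sheets agree locally, as descent requires.\<close>

lemma unit_measure_of_invariant_measure: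
  assumes x: "x \<in> units G"
    and \<mu>: "radon_measure (rfib_top G x) \<mu>" "fully_supported (rfib_top G x) \<mu>" "isotropy_invariant G x \<mu>"
  obtains \<nu> where "radon_measure (unit_top G) \<nu>" "fully_supported (unit_top G) \<nu>"
proof -
  have s\<mu>: "sets \<mu> = sets (borel_of (rfib_top G x))" "space \<mu> = rfib G x"
    using \<mu> by (simp_all add: radon_measure_sets radon_measure_space topspace_rfib_top)
  have surj: "topspace (unit_top G) \<subseteq> s ` topspace (rfib_top G x)"
    using src_surj[OF x] by (simp add: topspace_rfib_top topspace_unit_top)
  have compat: "\<exists>W. openin (unit_top G) W \<and> q \<in> W \<and> (\<forall>B \<in> sets (borel_of (unit_top G)). B \<subseteq> W \<longrightarrow>
        emeasure \<mu> {a \<in> U. s a \<in> B} = emeasure \<mu> {a \<in> V. s a \<in> B})"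
    if U: "sheet_at x U" and V: "sheet_at x V" and q: "q \<in> s ` U \<inter> s ` V" for U V q
  proof -
    obtain a b where ab: "a \<in> U" "b \<in> V" "s a = q" "s b = q"
      using q by auto
    have a: "a \<in> arrows G" "r a = x" and b: "b \<in> arrows G" "r b = x"
      using sheet_at_arrow[OF U ab(1)] sheet_at_arrow[OF V ab(2)] by auto
    \<comment> \<open>The deck transformation that carries \<open>a\<close> to
      \<open>b\<close>.\<close>
    define g where "g = b \<cdot> inv_arrow a"
    have g: "g \<in> arrows G" "r g = x" "s g = x"
      using a b ab by (simp_all add: g_def mult_props inv_props)
    have ga: "g \<cdot> a = b"
      unfolding g_def using a b ab arrow_props(4)[OF b(1)] by (simp add: mult_assoc inv_props)
    \<comment> \<open>The part of \<open>U\<close> that \<open>g\<close> carries into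
      \<open>V\<close>; its image under \<open>s\<close> is the neighbourhood of \<open>q\<close> on
      which the two sheets are compared.\<close>
    define T where "T = U \<inter> {c \<in> rfib G x. g \<cdot> c \<in> V}"
    have "openin (rfib_top G x) {c \<in> topspace (rfib_top G x). g \<cdot> c \<in> V}"
      using openin_continuous_map_preimage[OF left_mult_continuous[OF g(1)]] sheet_open[OF V] g by simp
    then have T: "openin (rfib_top G x) T"
      using sheet_open[OF U] by (simp add: T_def topspace_rfib_top openin_Int)
    have "emeasure \<mu> {c \<in> U. s c \<in> B} = emeasure \<mu> {c \<in> V. s c \<in> B}"
      if B: "B \<in> sets (borel_of (unit_top G))" "B \<subseteq> s ` T" for B
    proof -
      let ?A = "{c \<in> U. s c \<in> B}"
      have AT: "?A \<subseteq> T"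
      proof
        fix c assume "c \<in> ?A"
        then obtain d where d: "c \<in> U" "d \<in> T" "s c = s d"
          using B(2) by auto
        then have "c = d"
          using sheet_inj[OF U] by (auto simp: T_def inj_on_def)
        with d show "c \<in> T"
          by simp
      qed
      \<comment> \<open>For \<open>c\<close> in \<open>T\<close> the arrow
        \<open>g \<cdot> c\<close> lies in \<open>V\<close> with the same source as
        \<open>c\<close>; injectivity of \<open>s\<close> on \<open>V\<close> identifies it as the
        only such arrow.\<close>
      have "(\<lambda>c. g \<cdot> c) ` ?A = {c \<in> V. s c \<in> B}"
      proof (intro equalityI subsetI)
        fix d assume "d \<in> (\<lambda>c. g \<cdot> c) ` ?A"
        then obtain c where c: "c \<in> T" "s c \<in> B" "d = g \<cdot> c"
          using AT by auto
        then show "d \<in> {c \<in> V. s c \<in> B}"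
          using g by (auto simp: T_def rfib_iff mult_props)
      next
        fix d assume "d \<in> {c \<in> V. s c \<in> B}"
        then have d: "d \<in> V" "s d \<in> B"
          by auto
        then obtain c where c: "c \<in> T" "s d = s c"
          using B(2) by auto
        have "s (g \<cdot> c) = s d" "g \<cdot> c \<in> V"
          using c g by (auto simp: T_def rfib_iff mult_props)
        then have "g \<cdot> c = d"
          using sheet_inj[OF V] d by (auto simp: inj_on_def)
        then show "d \<in> (\<lambda>c. g \<cdot> c) ` ?A"
          using c d by (auto simp: T_def)
      qed
      moreover have "?A \<in> sets \<mu>"
        using sheet_borel_preimage[OF U B(1)] s\<mu> by simp
      ultimately show ?thesis
        using \<mu>(3) g by (auto simp: isotropy_invariant_def isotropy_iff dest!: bspec[where x=g] bspec[where x="?A"])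
    qed
    moreover have "openin (unit_top G) (s ` T)"
      by (rule sheet_openin_image[OF U T]) (simp add: T_def)
    moreover have "a \<in> T"
      using ab a ga by (simp add: T_def rfib_iff)
    then have "q \<in> s ` T"
      using ab by auto
    ultimately show ?thesis
      by blast
  qed
  obtain \<nu> where \<nu>: "radon_measure (unit_top G) \<nu>"
    and \<nu>\<mu>: "\<And>U B. sheet_at x U \<Longrightarrow> B \<in> sets (borel_of (unit_top G)) \<Longrightarrow> B \<subseteq> s ` U \<Longrightarrow>
      emeasure \<nu> B = emeasure \<mu> {a \<in> U. s a \<in> B}"
    using radon_measure_descend[OF src_local_homeomorphism[OF x] surj \<mu>(1) compat] by blast
  show thesis
  proof
    show "radon_measure (unit_top G) \<nu>"
      by fact
    show "fully_supported (unit_top G) \<nu>"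
      unfolding fully_supported_iff
    proof (intro allI impI)
      fix W assume "openin (unit_top G) W \<and> W \<noteq> {}"
      then obtain q where W: "openin (unit_top G) W" "q \<in> W"
        by blast
      then obtain a where a: "a \<in> arrows G" "r a = x" "s a = q"
        using transitive[OF x, of q] openin_subset[OF W(1)] by (auto simp: topspace_unit_top)
      then obtain U where U: "sheet_at x U" "a \<in> U"
        using obtain_sheet by metis
      let ?B = "W \<inter> s ` U"
      have B: "?B \<in> sets (borel_of (unit_top G))"
        using openin_borel_of[OF W(1)] sheet_borel[OF U(1)] by auto
      have "openin (rfib_top G x) {c \<in> U. s c \<in> W}"
        using sheet_openin_preimage[OF U(1) W(1)] .
      moreover have "a \<in> {c \<in> U. s c \<in> W}"
        using U W a by auto
      ultimately have "emeasure \<mu> {c \<in> U. s c \<in> W} \<noteq> 0"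
        using \<mu>(2) unfolding fully_supported_iff by blast
      moreover have "{c \<in> U. s c \<in> W} = {c \<in> U. s c \<in> ?B}"
        by auto
      ultimately have "emeasure \<nu> ?B \<noteq> 0"
        using \<nu>\<mu>[OF U(1) B] by simp
      moreover have "emeasure \<nu> ?B \<le> emeasure \<nu> W"
        using openin_borel_of[OF W(1)] radon_measure_sets[OF \<nu>] by (intro emeasure_mono) auto
      ultimately show "emeasure \<nu> W \<noteq> 0"
        by auto
    qed
  qed
qed

end

section \<open>Compactly supported functions and null sets of Radon measures\<close>

lemma continuous_map_euclideanI:
  fixes f :: "'a \<Rightarrow> 'b::metric_space"
  assumes "\<And>p e. p \<in> topspace X \<Longrightarrow> e > 0 \<Longrightarrow> \<exists>U. openin X U \<and> p \<in> U \<and> (\<forall>q \<in> U. dist (f q) (f p) < e)"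
  shows "continuous_map X euclidean f"
  unfolding continuous_map_def
proof (intro conjI allI impI)
  fix V :: "'b set" assume "openin euclidean V"
  then have V: "open V"
    by simp
  show "openin X {p \<in> topspace X. f p \<in> V}"
  proof (subst openin_subopen, intro ballI)
    fix p assume "p \<in> {p \<in> topspace X. f p \<in> V}"
    then have p: "p \<in> topspace X" "f p \<in> V"
      by auto
    then obtain e where e: "e > 0" "\<And>y. dist y (f p) < e \<Longrightarrow> y \<in> V"
      using V unfolding open_dist by blast
    then obtain U where "openin X U" "p \<in> U" "\<forall>q \<in> U. dist (f q) (f p) < e"
      using assms[OF p(1)] by blast
    then show "\<exists>T. openin X T \<and> p \<in> T \<and> T \<subseteq> {p \<in> topspace X. f p \<in> V}"
      using e openin_subset[of X U] by (intro exI[of _ U]) auto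
  qed
qed simp

text \<open>Extension by zero is continuous because compact sets are closed: outside
  \<open>U\<close> the complement of \<open>K\<close> is a neighbourhood on which the function
  vanishes. Sums inherit continuity and a compact set containing the support.\<close>

lemma Cc_Hausdorff:
  assumes X: "Hausdorff_space X" and f: "f \<in> Cc X"
  shows "continuous_map X euclidean f \<and> (\<exists>K. compactin X K \<and> (\<forall>p \<in> topspace X - K. f p = 0))"
  using f
proof induction
  case (generator U f K)
  have "continuous_map X euclidean f"
  proof (rule continuous_map_euclideanI)
    fix p and e :: real assume p: "p \<in> topspace X" "e > 0"
    show "\<exists>V. openin X V \<and> p \<in> V \<and> (\<forall>q \<in> V. dist (f q) (f p) < e)"
    proof (cases "p \<in> U")
      case True
      have "openin (subtopology X U) {q \<in> topspace (subtopology X U). f q \<in> ball (f p) e}"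
        by (rule openin_continuous_map_preimage[OF generator(3)]) simp
      then have "openin X {q \<in> topspace (subtopology X U). f q \<in> ball (f p) e}"
        using openin_open_subtopology[OF generator(1)] by blast
      then show ?thesis
        using True p by (intro exI[of _ "{q \<in> topspace (subtopology X U). f q \<in> ball (f p) e}"]) (auto simp: dist_commute)
    next
      case False
      then have "openin X (topspace X - K)" "p \<in> topspace X - K"
        using p generator X by (auto intro: compactin_imp_closedin)
      then show ?thesis
        using generator(6) p(2) by (intro exI[of _ "topspace X - K"]) auto
    qed
  qed
  then show ?case
    using generator by blast
next
  case (add f g)
  then obtain K L where "compactin X K" "\<forall>p \<in> topspace X - K. f p = 0" "compactin X L" "\<forall>p \<in> topspace X - L. g p = 0"
    by blast
  then have "compactin X (K \<union> L) \<and> (\<forall>p \<in> topspace X - (K \<union> L). f p + g p = 0)"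
    by (auto intro: compactin_Un)
  then show ?case
    using add by (blast intro: continuous_map_add)
qed

lemma radon_measure_integrable_Cc:
  assumes X: "Hausdorff_space X" and M: "radon_measure X M" and f: "f \<in> Cc X"
  shows "integrable M f"
proof -
  have sM: "sets M = sets (borel_of X)" "space M = topspace X"
    using M by (simp_all add: radon_measure_sets radon_measure_space)
  obtain K where cf: "continuous_map X euclidean f" and K: "compactin X K" "\<forall>p \<in> topspace X - K. f p = 0"
    using Cc_Hausdorff[OF X f] by blast
  have KM: "K \<in> sets M"
    using compactin_borel_of[OF X K(1)] sM by simp
  have "compact (f ` K)"
    using image_compactin[OF K(1) cf] by simp
  then obtain b where b: "\<And>p. p \<in> K \<Longrightarrow> norm (f p) \<le> b"
    using compact_imp_bounded bounded_iff by (metis imageI)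
  show ?thesis
  proof (rule integrableI_bounded_set[where A=K and B=b])
    show "f \<in> borel_measurable M"
      using borel_measurable_continuous_map[OF cf] by (simp add: measurable_cong_sets[OF sM(1) refl])
    show "emeasure M K < \<infinity>"
      by (rule radon_measure_emeasure_compact_finite[OF X M K(1)])
  qed (use KM K b sM in auto)
qed

text \<open>\<open>W\<close> is a possibly uncountable union of null open sets, so countable
  subadditivity does not suffice; comparison with the zero measure through
  \<open>emeasure_le_of_local_le\<close> does.\<close>

lemma radon_measure_null_off_support:
  assumes M: "radon_measure X M" and W: "openin X W" "W \<inter> measure_support X M = {}"
  shows "emeasure M W = 0"
proof -
  have sM: "sets M = sets (borel_of X)"
    using M by (simp add: radon_measure_sets)
  define \<W> where "\<W> = {U. openin X U \<and> emeasure M U = 0}"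
  have "emeasure M W \<le> emeasure (null_measure M) W"
  proof (rule emeasure_le_of_local_le)
    show "sets M = sets (borel_of X)" "sets (null_measure M) = sets (borel_of X)" "W \<in> sets (borel_of X)"
      using sM openin_borel_of[OF W(1)] by simp_all
    then show "emeasure M W \<le> (SUP K \<in> {K \<in> sets M. K \<subseteq> W \<and> compactin X K}. emeasure M K)"
      using M by (simp add: radon_measure_iff)
    show "W \<subseteq> \<Union>\<W>"
      using W openin_subset[OF W(1)] unfolding measure_support_def \<W>_def by fastforce
    show "openin X U" if "U \<in> \<W>" for U
      using that by (simp add: \<W>_def)
    fix U B assume "U \<in> \<W>" "B \<subseteq> W \<inter> U"
    then have "emeasure M B \<le> emeasure M U"
      using sM openin_borel_of by (intro emeasure_mono) (auto simp: \<W>_def)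
    with \<open>U \<in> \<W>\<close> show "emeasure M B \<le> emeasure (null_measure M) B"
      by (simp add: \<W>_def)
  qed
  then show ?thesis
    by simp
qed

section \<open>Translates of a measure and Haar systems\<close>

context lt_groupoid
begin

text \<open>The push-forward lands in the whole arrow space, since the members of a Haar system are
  measures on \<open>G\<close> supported on a fibre.\<close>

definition translate :: "'a measure \<Rightarrow> 'a \<Rightarrow> 'a measure" where
  "translate \<mu> c = distr \<mu> (borel_of (gtop G)) (\<lambda>a. c \<cdot> a)"

context
  fixes \<mu> c
  assumes c: "c \<in> arrows G" and \<mu>: "radon_measure (rfib_top G (s c)) \<mu>"
begin

lemma measurable_left_mult: "(\<lambda>a. c \<cdot> a) \<in> measurable \<mu> (borel_of (gtop G))"
  using measurable_borel_of[OF continuous_map_rfib_topD[OF left_mult_continuous[OF c]]]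
  by (simp add: measurable_cong_sets[OF radon_measure_sets[OF \<mu>] refl])

lemma radon_measure_translate: "radon_measure (gtop G) (translate \<mu> c)"
  unfolding translate_def
  using left_mult_homeomorphic[OF c] closedin_rfib[OF arrow_props(1)[OF c]]
  by (intro radon_measure_distr[OF Hausdorff_arrows \<mu>]) (auto simp: rfib_top_def)

lemma emeasure_translate:
  "B \<in> sets (borel_of (gtop G)) \<Longrightarrow> emeasure (translate \<mu> c) B = emeasure \<mu> {a \<in> rfib G (s c). c \<cdot> a \<in> B}"
  unfolding translate_def using emeasure_distr[OF measurable_left_mult]
  by (simp add: radon_measure_space[OF \<mu>] topspace_rfib_top vimage_def Int_def conj_commute)

lemma integral_translate:
  fixes f :: "'a \<Rightarrow> complex"
  shows "f \<in> borel_measurable (borel_of (gtop G)) \<Longrightarrow> (\<integral>a. f a \<partial>translate \<mu> c) = (\<integral>a. f (c \<cdot> a) \<partial>\<mu>)"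
  unfolding translate_def by (rule integral_distr[OF measurable_left_mult])

lemma support_translate:
  assumes "fully_supported (rfib_top G (s c)) \<mu>"
  shows "measure_support (gtop G) (translate \<mu> c) = rfib G (r c)"
proof (intro equalityI subsetI)
  fix p assume p: "p \<in> measure_support (gtop G) (translate \<mu> c)"
  show "p \<in> rfib G (r c)"
  proof (rule ccontr)
    let ?W = "topspace (gtop G) - rfib G (r c)"
    assume "p \<notin> rfib G (r c)"
    then have "p \<in> ?W"
      using p by (auto simp: measure_support_def)
    moreover have W: "openin (gtop G) ?W"
      using closedin_rfib[OF arrow_props(1)[OF c]] by blast
    moreover have "{a \<in> rfib G (s c). c \<cdot> a \<in> ?W} = {}"
      using mult_rfib(1)[OF c] by auto
    then have "emeasure (translate \<mu> c) ?W = 0"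
      by (simp only: emeasure_translate[OF openin_borel_of[OF W]] emeasure_empty)
    ultimately show False
      using p by (auto simp: measure_support_def)
  qed
next
  fix p assume "p \<in> rfib G (r c)"
  then have p: "p \<in> arrows G" "r p = r c"
    by (auto simp: rfib_iff)
  have "emeasure (translate \<mu> c) W \<noteq> 0" if W: "openin (gtop G) W" "p \<in> W" for W
  proof -
    have "inv_arrow c \<cdot> p \<in> {a \<in> rfib G (s c). c \<cdot> a \<in> W}"
      using p W c by (simp add: rfib_iff inv_props mult_props mult_inv_cancel)
    moreover have "openin (rfib_top G (s c)) {a \<in> rfib G (s c). c \<cdot> a \<in> W}"
      using openin_continuous_map_preimage[OF continuous_map_rfib_topD[OF left_mult_continuous[OF c]] W(1)]
      by (simp add: topspace_rfib_top)
    ultimately show ?thesis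
      using assms unfolding fully_supported_iff emeasure_translate[OF openin_borel_of[OF W(1)]] by blast
  qed
  then show "p \<in> measure_support (gtop G) (translate \<mu> c)"
    using p by (auto simp: measure_support_def topspace_gtop)
qed

end

lemma rfib_borel: "u \<in> units G \<Longrightarrow> rfib G u \<in> sets (borel_of (gtop G))"
  using closedin_borel_of[OF closedin_rfib] .

lemma Cc_borel_measurable: "f \<in> Cc (gtop G) \<Longrightarrow> f \<in> borel_measurable (borel_of (gtop G))"
  using Cc_Hausdorff[OF Hausdorff_arrows] borel_measurable_continuous_map by blast

text \<open>The Haar identity speaks of functions in \<open>Cc\<close> of the whole of
  \<open>G\<close>. Therefore the translate by \<open>g\<close> and the translate by the unit
  \<open>x\<close>, which merely embeds the fibre, are compared as Radon measures on
  \<open>G\<close>.\<close>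

lemma invariant_measure_of_haar_system:
  assumes x: "x \<in> units G" and \<alpha>: "haar_system G \<alpha>"
  obtains \<mu> where "radon_measure (rfib_top G x) \<mu>" "fully_supported (rfib_top G x) \<mu>" "isotropy_invariant G x \<mu>"
proof
  let ?\<mu> = "restrict_space (\<alpha> x) (rfib G x)"
  have \<alpha>x: "radon_measure (gtop G) (\<alpha> x)" "measure_support (gtop G) (\<alpha> x) = rfib G x"
    using \<alpha> x by (auto simp: haar_system_def)
  have s\<alpha>: "sets (\<alpha> x) = sets (borel_of (gtop G))" "space (\<alpha> x) = arrows G"
    using \<alpha>x(1) by (simp_all add: radon_measure_sets radon_measure_space topspace_gtop)
  have C: "closedin (gtop G) (rfib G x)"
    using closedin_rfib[OF x] .
  have C': "rfib G x \<inter> space (\<alpha> x) \<in> sets (\<alpha> x)"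
    using closedin_borel_of[OF C] by (metis s\<alpha>(1) sets.Int_space_eq2)
  show \<mu>: "radon_measure (rfib_top G x) ?\<mu>"
    unfolding rfib_top_def by (rule radon_measure_restrict[OF \<alpha>x(1) C])
  have em: "emeasure ?\<mu> B = emeasure (\<alpha> x) B" if "B \<subseteq> rfib G x" for B
    using that C' by (rule emeasure_restrict_space[rotated])
  show "fully_supported (rfib_top G x) ?\<mu>"
    unfolding fully_supported_iff
  proof (intro allI impI)
    fix W assume W: "openin (rfib_top G x) W \<and> W \<noteq> {}"
    then obtain O' where O': "openin (gtop G) O'" "W = O' \<inter> rfib G x"
      by (auto simp: rfib_top_def openin_subtopology)
    have N: "openin (gtop G) (topspace (gtop G) - rfib G x)"
      using C by blast
    \<comment> \<open>\<open>O'\<close> exceeds \<open>W\<close> only by points off the fibre, that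
      is off the support, and these form a null set. So \<open>W\<close> inherits the positive
      measure of \<open>O'\<close>.\<close>
    have "emeasure (\<alpha> x) O' \<le> emeasure (\<alpha> x) (W \<union> (topspace (gtop G) - rfib G x))"
      using openin_subset[OF O'(1)] openin_borel_of[OF O'(1)] openin_borel_of[OF N] closedin_borel_of[OF C] s\<alpha> O'(2)
      by (intro emeasure_mono) auto
    also have "\<dots> \<le> emeasure (\<alpha> x) W + emeasure (\<alpha> x) (topspace (gtop G) - rfib G x)"
      using openin_borel_of[OF O'(1)] openin_borel_of[OF N] closedin_borel_of[OF C] s\<alpha> O'(2)
      by (intro emeasure_subadditive) auto
    also have "emeasure (\<alpha> x) (topspace (gtop G) - rfib G x) = 0"
      by (rule radon_measure_null_off_support[OF \<alpha>x(1) N]) (use \<alpha>x(2) in auto)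
    finally have "emeasure (\<alpha> x) O' \<le> emeasure ?\<mu> W"
      using em[of W] O'(2) by simp
    moreover obtain p where "p \<in> O'" "p \<in> measure_support (gtop G) (\<alpha> x)"
      using W O'(2) \<alpha>x(2) by auto
    then have "emeasure (\<alpha> x) O' \<noteq> 0"
      using O'(1) by (auto simp: measure_support_def)
    ultimately show "emeasure ?\<mu> W \<noteq> 0"
      by auto
  qed
  show "isotropy_invariant G x ?\<mu>"
    unfolding isotropy_invariant_def
  proof (intro ballI)
    fix g B assume "g \<in> isotropy G x" and "B \<in> sets ?\<mu>"
    then have g: "g \<in> arrows G" "r g = x" "s g = x" and B: "B \<in> sets (borel_of (rfib_top G x))"
      using radon_measure_sets[OF \<mu>] by (auto simp: isotropy_iff)
    have xx: "x \<in> arrows G" "s x = x"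
      using unit_props[OF x] by auto
    have \<mu>g: "radon_measure (rfib_top G (s g)) ?\<mu>" and \<mu>x: "radon_measure (rfib_top G (s x)) ?\<mu>"
      using \<mu> g xx by auto
    have "translate ?\<mu> g = translate ?\<mu> x"
    proof (rule radon_measure_eqI_Cc[OF Hausdorff_arrows locally_compact_arrows])
      show "radon_measure (gtop G) (translate ?\<mu> g)" "radon_measure (gtop G) (translate ?\<mu> x)"
        using radon_measure_translate[OF g(1) \<mu>g] radon_measure_translate[OF xx(1) \<mu>x] by auto
      fix f assume f: "f \<in> Cc (gtop G)"
      have "(\<integral>a. f a \<partial>translate ?\<mu> g) = (\<integral>a. f (g \<cdot> a) \<partial>?\<mu>)"
        by (rule integral_translate[OF g(1) \<mu>g Cc_borel_measurable[OF f]])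
      also have "\<dots> = (LINT a:rfib G x|\<alpha> x. f (g \<cdot> a))"
        unfolding set_lebesgue_integral_def by (rule integral_restrict_space[OF C'])
      also have "\<dots> = (LINT a:rfib G x|\<alpha> x. f a)"
        using \<alpha> g f unfolding haar_system_def by metis
      also have "\<dots> = (\<integral>a. f a \<partial>?\<mu>)"
        unfolding set_lebesgue_integral_def by (rule integral_restrict_space[OF C', symmetric])
      also have "\<dots> = (\<integral>a. f (x \<cdot> a) \<partial>?\<mu>)"
        using arrow_props(3) radon_measure_space[OF \<mu>]
        by (intro Bochner_Integration.integral_cong) (auto simp: topspace_rfib_top rfib_iff)
      also have "\<dots> = (\<integral>a. f a \<partial>translate ?\<mu> x)"
        by (rule integral_translate[OF xx(1) \<mu>x Cc_borel_measurable[OF f], symmetric])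
      finally show "(\<integral>a. f a \<partial>translate ?\<mu> g) = (\<integral>a. f a \<partial>translate ?\<mu> x)" .
    qed
    moreover have Bs: "B \<subseteq> rfib G x"
      using sets.sets_into_space[OF B] by (simp add: topspace_rfib_top)
    have gB: "(\<lambda>a. g \<cdot> a) ` B \<in> sets (borel_of (gtop G))" "(\<lambda>a. g \<cdot> a) ` B \<subseteq> rfib G x"
      using left_mult_borel[OF g(1)] B g sets_borel_of_subtopology_iff[OF rfib_borel[OF x]]
      by (auto simp: rfib_top_def)
    have "{a \<in> rfib G x. g \<cdot> a \<in> (\<lambda>a. g \<cdot> a) ` B} = B"
      using left_mult_vimage_image[OF g(1)] Bs g by simp
    then have "emeasure (translate ?\<mu> g) ((\<lambda>a. g \<cdot> a) ` B) = emeasure ?\<mu> B"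
      using emeasure_translate[OF g(1) \<mu>g gB(1)] g by simp
    moreover have "{a \<in> rfib G x. x \<cdot> a \<in> (\<lambda>a. g \<cdot> a) ` B} = (\<lambda>a. g \<cdot> a) ` B"
    proof -
      have "x \<cdot> a = a" if "a \<in> rfib G x" for a
        using that arrow_props(3) by (auto simp: rfib_iff)
      then show ?thesis
        using gB(2) by fastforce
    qed
    then have "emeasure (translate ?\<mu> x) ((\<lambda>a. g \<cdot> a) ` B) = emeasure ?\<mu> ((\<lambda>a. g \<cdot> a) ` B)"
      using emeasure_translate[OF xx(1) \<mu>x gB(1)] xx by simp
    ultimately show "emeasure ?\<mu> ((\<lambda>a. g \<cdot> a) ` B) = emeasure ?\<mu> B"
      by simp
  qed
qed

text \<open>Write \<open>d\<close> as \<open>c \<cdot> h\<close> with \<open>h\<close> in the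
  isotropy group at the common source. The preimage of \<open>B\<close> under \<open>c\<close> is
  then the \<open>h\<close>-translate of its preimage under \<open>d\<close>.\<close>

lemma translate_eq:
  assumes c: "c \<in> arrows G" and d: "d \<in> arrows G" and cd: "r c = r d" "s c = s d"
    and \<mu>: "radon_measure (rfib_top G (s c)) \<mu>" and inv: "isotropy_invariant G (s c) \<mu>"
  shows "translate \<mu> c = translate \<mu> d"
proof (rule measure_eqI)
  show "sets (translate \<mu> c) = sets (translate \<mu> d)"
    by (simp add: translate_def)
  fix B assume "B \<in> sets (translate \<mu> c)"
  then have B: "B \<in> sets (borel_of (gtop G))"
    by (simp add: translate_def)
  have \<mu>d: "radon_measure (rfib_top G (s d)) \<mu>"
    using \<mu> cd by simp
  define h where "h = inv_arrow c \<cdot> d"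
  have h: "h \<in> arrows G" "r h = s c" "s h = s c"
    using c d cd by (simp_all add: h_def inv_props mult_props)
  have ch: "c \<cdot> h = d"
    unfolding h_def using c d cd by (simp add: mult_inv_cancel)
  let ?A = "{a \<in> rfib G (s d). d \<cdot> a \<in> B}"
  have cha: "c \<cdot> (h \<cdot> a) = d \<cdot> a" if "a \<in> arrows G" "r a = s c" for a
    using mult_assoc[of c h a] c h ch that by simp
  have "(\<lambda>a. h \<cdot> a) ` ?A = {a \<in> rfib G (s c). c \<cdot> a \<in> B}"
  proof (intro equalityI subsetI)
    fix a assume "a \<in> (\<lambda>a. h \<cdot> a) ` ?A"
    then show "a \<in> {a \<in> rfib G (s c). c \<cdot> a \<in> B}"
      using cha h cd by (auto simp: rfib_iff mult_props)
  next
    fix a assume "a \<in> {a \<in> rfib G (s c). c \<cdot> a \<in> B}"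
    then have a: "a \<in> arrows G" "r a = s c" "c \<cdot> a \<in> B"
      by (auto simp: rfib_iff)
    let ?b = "inv_arrow h \<cdot> a"
    have b: "?b \<in> arrows G" "r ?b = s c" "h \<cdot> ?b = a"
      using h a by (simp_all add: inv_props mult_props mult_inv_cancel)
    then have "?b \<in> ?A"
      using cha[OF b(1,2)] a cd by (simp add: rfib_iff)
    then show "a \<in> (\<lambda>a. h \<cdot> a) ` ?A"
      using b(3) by (metis imageI)
  qed
  moreover have A: "?A \<in> sets \<mu>"
  proof -
    have "?A = (\<lambda>a. d \<cdot> a) -` B \<inter> space \<mu>"
      by (auto simp: radon_measure_space[OF \<mu>d] topspace_rfib_top)
    then show ?thesis
      using measurable_sets[OF measurable_left_mult[OF d \<mu>d] B] by simp
  qed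
  have "h \<in> isotropy G (s c)"
    using h by (simp add: isotropy_iff)
  with A have "emeasure \<mu> ((\<lambda>a. h \<cdot> a) ` ?A) = emeasure \<mu> ?A"
    using inv unfolding isotropy_invariant_def by blast
  ultimately show "emeasure (translate \<mu> c) B = emeasure (translate \<mu> d) B"
    by (simp only: emeasure_translate[OF c \<mu> B] emeasure_translate[OF d \<mu>d B])
qed

text \<open>\<open>r\<close> retracts the arrows onto the units, so the image of a compact
  neighbourhood is compact and contains its units.\<close>

lemma locally_compact_units: "locally_compact_space (unit_top G)"
  unfolding locally_compact_space_def
proof
  fix u assume "u \<in> topspace (unit_top G)"
  then have u: "u \<in> units G" "u \<in> arrows G" "r u = u"
    using unit_props by (auto simp: topspace_unit_top)
  then obtain O' K where O': "openin (gtop G) O'" "compactin (gtop G) K" "u \<in> O'" "O' \<subseteq> K"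
    using locally_compact_arrows unfolding locally_compact_space_def by (metis topspace_gtop)
  have "O' \<inter> units G \<subseteq> r ` K"
    using O'(4) unit_props(2) by force
  moreover have "openin (unit_top G) (O' \<inter> units G)"
    using O'(1) by (auto simp: unit_top_def openin_subtopology)
  moreover have "compactin (unit_top G) (r ` K)"
    using image_compactin[OF O'(2) rng_continuous] .
  ultimately show "\<exists>U K. openin (unit_top G) U \<and> compactin (unit_top G) K \<and> u \<in> U \<and> U \<subseteq> K"
    using u O'(3) by blast
qed

text \<open>Along a local section, the integral against the translates becomes an integral with a jointly
  continuous integrand whose support stays in a fixed compact set.\<close>

lemma translate_integral_continuous_at:
  fixes f :: "'a \<Rightarrow> complex"
  assumes c: "c \<in> arrows G" and \<mu>: "radon_measure (rfib_top G (s c)) \<mu>" and f: "f \<in> Cc (gtop G)" and e: "0 < e"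
  obtains U where "openin (unit_top G) U" "r c \<in> U"
    "\<And>u. u \<in> U \<Longrightarrow> \<exists>d \<in> arrows G. r d = u \<and> s d = s c \<and>
      dist (\<integral>a. f a \<partial>translate \<mu> d) (\<integral>a. f a \<partial>translate \<mu> c) < e"
proof -
  let ?x = "s c"
  have sp\<mu>: "sets \<mu> = sets (borel_of (rfib_top G ?x))" "space \<mu> = rfib G ?x"
    using \<mu> by (simp_all add: radon_measure_sets radon_measure_space topspace_rfib_top)
  obtain K where cf: "continuous_map (gtop G) euclidean f" and K: "compactin (gtop G) K"
      and f0: "\<forall>p \<in> topspace (gtop G) - K. f p = 0"
    using Cc_Hausdorff[OF Hausdorff_arrows f] by blast
  have ic: "inv_arrow c \<in> arrows G" "r (inv_arrow c) = ?x" "s (inv_arrow c) = r c"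
    using c by (simp_all add: inv_props)
  obtain V \<sigma> where V: "openin (unit_top G) V" "r c \<in> V" "continuous_map (subtopology (unit_top G) V) (gtop G) \<sigma>"
    and \<sigma>: "\<And>v. v \<in> V \<Longrightarrow> \<sigma> v \<in> arrows G" "\<And>v. v \<in> V \<Longrightarrow> r (\<sigma> v) = ?x" "\<And>v. v \<in> V \<Longrightarrow> s (\<sigma> v) = v" "\<sigma> (r c) = inv_arrow c"
    using local_section[OF ic(1)] unfolding ic(2,3) by metis
  \<comment> \<open>Inverting a section of \<open>s\<close> with constant range gives a section of
    \<open>r\<close> with constant source, passing through \<open>c\<close>.\<close>
  define \<tau> where "\<tau> v = inv_arrow (\<sigma> v)" for v
  have \<tau>: "\<tau> v \<in> arrows G" "r (\<tau> v) = v" "s (\<tau> v) = ?x" if "v \<in> V" for v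
    using \<sigma> that by (simp_all add: \<tau>_def inv_props)
  have \<tau>c: "\<tau> (r c) = c"
    using inv_mult_cancel[OF ic(1) c] inv_props[OF ic(1)] inv_props(4)[OF c] ic
      arrow_props(4)[OF inv_props(1)[OF ic(1)]] by (simp add: \<tau>_def \<sigma>(4))
  have Vt: "topspace (subtopology (unit_top G) V) = V"
    using openin_subset[OF V(1)] by auto
  have "neighbourhood_base_of (compactin (unit_top G)) (unit_top G)"
    using locally_compact_units Hausdorff_units locally_compact_space_neighbourhood_base by blast
  then obtain N C where N: "openin (unit_top G) N" "compactin (unit_top G) C" "r c \<in> N" "N \<subseteq> C" "C \<subseteq> V"
    using V unfolding neighbourhood_base_of by metis
  \<comment> \<open>\<open>KC\<close> is the part of \<open>K\<close> over the compact neighbourhood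
    \<open>C\<close>, and \<open>L\<close> pulls it back to the fibre along the section. If
    \<open>f\<close> is nonzero at \<open>\<tau> u \<cdot> a\<close> with \<open>u\<close> in
    \<open>C\<close>, that arrow lies in \<open>KC\<close> and \<open>a\<close> is recovered from it
    in \<open>L\<close>; so \<open>L\<close> serves all \<open>u\<close> in \<open>C\<close> at
    once.\<close>
  define KC where "KC = {k \<in> arrows G. r k \<in> C} \<inter> K"
  define L where "L = (\<lambda>k. \<sigma> (r k) \<cdot> k) ` KC"
  have KC: "compactin (gtop G) KC"
  proof -
    have "closedin (unit_top G) C"
      using N(2) Hausdorff_units by (rule compactin_imp_closedin[rotated])
    then have "closedin (gtop G) {k \<in> arrows G. r k \<in> C}"
      using closedin_continuous_map_preimage[OF rng_continuous] by (simp add: topspace_gtop)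
    then show ?thesis
      unfolding KC_def using K by (rule closed_Int_compactin)
  qed
  have KCV: "k \<in> arrows G" "r k \<in> V" if "k \<in> KC" for k
    using that N(5) by (auto simp: KC_def)
  have KCt: "topspace (subtopology (gtop G) KC) = KC"
    using KCV(1) by (auto simp: topspace_gtop)
  have L: "compactin (gtop G) L"
  proof -
    have "continuous_map (subtopology (gtop G) KC) (subtopology (unit_top G) V) r"
      using rng_continuous KCV by (auto simp: continuous_map_in_subtopology continuous_map_from_subtopology KCt simp del: topspace_subtopology)
    then have "continuous_map (subtopology (gtop G) KC) (gtop G) (\<lambda>k. \<sigma> (r k))"
      using continuous_map_compose[OF _ V(3)] by (auto simp: o_def)
    moreover have "continuous_map (subtopology (gtop G) KC) (gtop G) (\<lambda>k. k)"
      using continuous_map_from_subtopology[OF continuous_map_id] by (simp add: id_def)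
    ultimately have "continuous_map (subtopology (gtop G) KC) (gtop G) (\<lambda>k. \<sigma> (r k) \<cdot> k)"
      by (rule mult_continuous) (use KCV \<sigma> in \<open>auto simp: KCt simp del: topspace_subtopology\<close>)
    moreover have "compactin (subtopology (gtop G) KC) KC"
      using KC by (simp add: compactin_subtopology)
    ultimately show ?thesis
      unfolding L_def by (intro image_compactin)
  qed
  have Lr: "L \<subseteq> rfib G ?x"
    using KCV \<sigma> by (auto simp: L_def rfib_iff mult_props)
  have Lx: "compactin (rfib_top G ?x) L"
    using L Lr by (simp add: rfib_top_def compactin_subtopology)
  have L\<mu>: "L \<in> sets \<mu>"
    using compactin_borel_of[OF Hausdorff_rfib Lx] sp\<mu> by simp
  have Lfin: "emeasure \<mu> L < \<infinity>"
    by (rule radon_measure_emeasure_compact_finite[OF Hausdorff_rfib \<mu> Lx])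
  define h where "h u a = f (\<tau> u \<cdot> a)" for u a
  have h0: "h u a = 0" if u: "u \<in> C" and a: "a \<in> rfib G ?x" "a \<notin> L" for u a
  proof (rule ccontr)
    assume "h u a \<noteq> 0"
    have uV: "u \<in> V"
      using u N by blast
    have a': "a \<in> arrows G" "r a = ?x"
      using a by (auto simp: rfib_iff)
    have k: "\<tau> u \<cdot> a \<in> arrows G" "r (\<tau> u \<cdot> a) = u"
      using \<tau>[OF uV] a' by (simp_all add: mult_props)
    with \<open>h u a \<noteq> 0\<close> have "\<tau> u \<cdot> a \<in> KC"
      using f0 u by (auto simp: h_def KC_def topspace_gtop)
    moreover have "a = \<sigma> (r (\<tau> u \<cdot> a)) \<cdot> (\<tau> u \<cdot> a)"
      unfolding k(2) unfolding \<tau>_def using \<sigma> uV a' by (intro mult_inv_cancel[symmetric]) auto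
    ultimately have "a \<in> L"
      unfolding L_def by (rule image_eqI[rotated])
    with a show False
      by blast
  qed
  have hcont: "continuous_map (prod_topology (subtopology (unit_top G) V) (rfib_top G ?x)) euclidean (\<lambda>(u, a). h u a)"
  proof -
    let ?P = "prod_topology (subtopology (unit_top G) V) (rfib_top G ?x)"
    have "continuous_map (subtopology (unit_top G) V) (gtop G) \<tau>"
      using continuous_map_compose[OF V(3) inv_continuous] by (simp add: o_def \<tau>_def[abs_def])
    then have 1: "continuous_map ?P (gtop G) (\<lambda>z. \<tau> (fst z))"
      using continuous_map_compose[OF continuous_map_fst] by (fastforce simp: o_def)
    have 2: "continuous_map ?P (gtop G) snd"
      using continuous_map_rfib_topD[OF continuous_map_snd] .
    have "continuous_map ?P (gtop G) (\<lambda>z. \<tau> (fst z) \<cdot> snd z)"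
      using 1 2 by (rule mult_continuous) (auto simp: topspace_rfib_top rfib_iff \<tau>)
    from continuous_map_compose[OF this cf] show ?thesis
      by (simp add: o_def h_def case_prod_unfold)
  qed
  \<comment> \<open>Adding 1 keeps the denominator positive when \<open>L\<close> is null and makes
    the final inequality strict.\<close>
  define \<delta> where "\<delta> = e / (measure \<mu> L + 1)"
  have mL: "measure \<mu> L + 1 > 0"
    by (simp add: add_nonneg_pos)
  then have \<delta>: "\<delta> > 0" "\<delta> * measure \<mu> L < e"
    using e by (simp_all add: \<delta>_def pos_divide_less_eq algebra_simps)
  define W where "W = {z \<in> V \<times> rfib G ?x. norm (h (fst z) (snd z) - h (r c) (snd z)) < \<delta>}"
  have W: "openin (prod_topology (subtopology (unit_top G) V) (rfib_top G ?x)) W"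
  proof -
    let ?P = "prod_topology (subtopology (unit_top G) V) (rfib_top G ?x)"
    have Pt: "topspace ?P = V \<times> rfib G ?x"
      by (simp only: topspace_prod_topology Vt topspace_rfib_top)
    have "continuous_map (rfib_top G ?x) euclidean (\<lambda>a. h (r c) a)"
    proof -
      have "continuous_map (rfib_top G ?x) euclidean (\<lambda>a. f (c \<cdot> a))"
        using continuous_map_compose[OF continuous_map_rfib_topD[OF left_mult_continuous[OF c]] cf] by (simp add: o_def)
      then show ?thesis
        by (simp add: h_def \<tau>c)
    qed
    then have "continuous_map ?P euclidean (\<lambda>z. h (r c) (snd z))"
      using continuous_map_compose[OF continuous_map_snd] by (fastforce simp: o_def)
    with hcont have "continuous_map ?P euclidean (\<lambda>z. norm (h (fst z) (snd z) - h (r c) (snd z)))"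
      by (intro continuous_map_norm continuous_map_diff) (simp_all add: case_prod_unfold)
    from openin_continuous_map_preimage[OF this, of "{..<\<delta>}"] show ?thesis
      unfolding Pt W_def by simp
  qed
  have rcV: "r c \<in> topspace (subtopology (unit_top G) V)"
    using V(2) by (simp only: Vt)
  have rcL: "{r c} \<times> L \<subseteq> W"
    using V(2) Lr \<delta>(1) by (auto simp: W_def)
  \<comment> \<open>Compactness of \<open>L\<close> turns pointwise closeness along the slice over
    \<open>r c\<close> into closeness uniform in \<open>a\<close>, by the tube lemma.\<close>
  obtain U U' where U: "openin (subtopology (unit_top G) V) U" "r c \<in> U" "L \<subseteq> U'" "U \<times> U' \<subseteq> W"
    using tube_lemma_right[OF W Lx rcV rcL] by metis
  have UV: "openin (unit_top G) U" "U \<subseteq> V"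
    using U(1) V(1) openin_open_subtopology by blast+
  have int: "integrable \<mu> (h u)" and eqi: "(\<integral>a. f a \<partial>translate \<mu> (\<tau> u)) = (\<integral>a. h u a \<partial>\<mu>)" if "u \<in> V" for u
  proof -
    have \<mu>u: "radon_measure (rfib_top G (s (\<tau> u))) \<mu>"
      using \<mu> \<tau>[OF that] by simp
    show "(\<integral>a. f a \<partial>translate \<mu> (\<tau> u)) = (\<integral>a. h u a \<partial>\<mu>)"
      unfolding h_def by (rule integral_translate[OF \<tau>(1)[OF that] \<mu>u Cc_borel_measurable[OF f]])
    have "integrable (translate \<mu> (\<tau> u)) f"
      by (rule radon_measure_integrable_Cc[OF Hausdorff_arrows radon_measure_translate[OF \<tau>(1)[OF that] \<mu>u] f])
    then show "integrable \<mu> (h u)"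
      unfolding translate_def h_def[abs_def]
      using integrable_distr_eq[OF measurable_left_mult[OF \<tau>(1)[OF that] \<mu>u] Cc_borel_measurable[OF f]] by simp
  qed
  show thesis
  proof
    \<comment> \<open>\<open>U\<close> controls the integrand on \<open>L\<close>, and
      \<open>N\<close>, lying in \<open>C\<close>, makes it vanish off \<open>L\<close>.\<close>
    show "openin (unit_top G) (U \<inter> N)" "r c \<in> U \<inter> N"
      using UV N U by auto
    fix u assume u: "u \<in> U \<inter> N"
    then have uV: "u \<in> V" "u \<in> C"
      using UV N by auto
    have rcC: "r c \<in> C"
      using N by blast
    have bound: "norm (h u a - h (r c) a) \<le> \<delta> * indicator L a" if a: "a \<in> space \<mu>" for a
    proof (cases "a \<in> L")
      case True
      then have "(u, a) \<in> W"
        using u U by auto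
      then show ?thesis
        using True by (simp add: W_def)
    next
      case False
      then show ?thesis
        using h0[OF uV(2)] h0[OF rcC] a sp\<mu> by simp
    qed
    have "dist (\<integral>a. f a \<partial>translate \<mu> (\<tau> u)) (\<integral>a. f a \<partial>translate \<mu> (\<tau> (r c))) =
        norm (\<integral>a. h u a - h (r c) a \<partial>\<mu>)"
      using int eqi uV V(2) by (simp add: dist_norm)
    also have "\<dots> \<le> (\<integral>a. norm (h u a - h (r c) a) \<partial>\<mu>)"
      by (rule integral_norm_bound)
    also have "\<dots> \<le> (\<integral>a. \<delta> * indicator L a \<partial>\<mu>)"
    proof (rule integral_mono)
      show "integrable \<mu> (\<lambda>a. norm (h u a - h (r c) a))"
        using int uV V(2) by (intro integrable_norm Bochner_Integration.integrable_diff) auto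
      show "integrable \<mu> (\<lambda>a. \<delta> * indicator L a)"
        using L\<mu> Lfin by (intro integrable_mult_right) simp
    qed (rule bound)
    also have "\<dots> = \<delta> * measure \<mu> L"
      using sets.sets_into_space[OF L\<mu>] by (simp add: Int_absorb2)
    also have "\<dots> < e"
      by (rule \<delta>)
    finally have "dist (\<integral>a. f a \<partial>translate \<mu> (\<tau> u)) (\<integral>a. f a \<partial>translate \<mu> c) < e"
      by (simp only: \<tau>c)
    then show "\<exists>d \<in> arrows G. r d = u \<and> s d = ?x \<and>
        dist (\<integral>a. f a \<partial>translate \<mu> d) (\<integral>a. f a \<partial>translate \<mu> c) < e"
      using \<tau>[OF uV(1)] by blast
  qed
qed

text \<open>Continuity of \<open>f\<close> is asked only on the fibre, because in the Haar identity
  the integrand \<open>f (g \<cdot> a)\<close> is meaningful only there; the indicator in the set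
  integral removes the other values.\<close>

lemma set_integral_translate:
  fixes f :: "'a \<Rightarrow> complex"
  assumes c: "c \<in> arrows G" and \<mu>: "radon_measure (rfib_top G (s c)) \<mu>"
    and f: "continuous_map (rfib_top G (r c)) euclidean f"
  shows "(LINT a:rfib G (r c)|translate \<mu> c. f a) = (\<integral>a. f (c \<cdot> a) \<partial>\<mu>)"
proof -
  have R: "rfib G (r c) \<in> sets (borel_of (gtop G))"
    using rfib_borel[OF arrow_props(1)[OF c]] .
  have "f \<in> borel_measurable (restrict_space (borel_of (gtop G)) (rfib G (r c)))"
    using borel_measurable_continuous_map[OF f]
    by (simp add: rfib_top_def measurable_cong_sets[OF sets_borel_of_subtopology[OF R] refl])
  then have "(\<lambda>a. indicator (rfib G (r c)) a *\<^sub>R f a) \<in> borel_measurable (borel_of (gtop G))"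
    by (subst (asm) borel_measurable_restrict_space_iff) (rule sets.Int[OF R sets.top])
  then have "(LINT a:rfib G (r c)|translate \<mu> c. f a) = (\<integral>a. indicator (rfib G (r c)) (c \<cdot> a) *\<^sub>R f (c \<cdot> a) \<partial>\<mu>)"
    unfolding set_lebesgue_integral_def by (rule integral_translate[OF c \<mu>])
  also have "\<dots> = (\<integral>a. f (c \<cdot> a) \<partial>\<mu>)"
    using mult_rfib(1)[OF c] radon_measure_space[OF \<mu>]
    by (intro Bochner_Integration.integral_cong) (auto simp: topspace_rfib_top)
  finally show ?thesis .
qed

text \<open>All three Haar axioms are read off from translates, with \<open>\<alpha>_eq\<close>
  replacing the chosen arrow \<open>c u\<close> by whichever arrow from \<open>x\<close> to
  \<open>u\<close> suits the axiom.\<close>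

lemma haar_system_of_invariant_measure:
  assumes x: "x \<in> units G"
    and \<mu>: "radon_measure (rfib_top G x) \<mu>" "fully_supported (rfib_top G x) \<mu>" "isotropy_invariant G x \<mu>"
  obtains \<alpha> where "haar_system G \<alpha>"
proof
  define c where "c u = (SOME c. c \<in> arrows G \<and> r c = u \<and> s c = x)" for u
  have "\<exists>c. c \<in> arrows G \<and> r c = u \<and> s c = x" if "u \<in> units G" for u
    using transitive[OF that x] by metis
  then have c: "c u \<in> arrows G" "r (c u) = u" "s (c u) = x" if "u \<in> units G" for u
    using someI_ex[of "\<lambda>c. c \<in> arrows G \<and> r c = u \<and> s c = x"] that by (auto simp: c_def)
  define \<alpha> where "\<alpha> u = translate \<mu> (c u)" for u
  have \<mu>x: "radon_measure (rfib_top G (s d)) \<mu>" "fully_supported (rfib_top G (s d)) \<mu>" if "s d = x" for d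
    using \<mu> that by auto
  have \<alpha>_eq: "\<alpha> u = translate \<mu> d" if "u \<in> units G" "d \<in> arrows G" "r d = u" "s d = x" for u d
    unfolding \<alpha>_def by (rule translate_eq) (use c[OF that(1)] that \<mu> in auto)
  show "haar_system G \<alpha>"
    unfolding haar_system_def
  proof (intro conjI ballI)
    fix u assume u: "u \<in> units G"
    show "radon_measure (gtop G) (\<alpha> u)"
      unfolding \<alpha>_def using radon_measure_translate[OF c(1)[OF u] \<mu>x(1)] c[OF u] by simp
    show "measure_support (gtop G) (\<alpha> u) = rfib G u"
      unfolding \<alpha>_def using support_translate[OF c(1)[OF u] \<mu>x(1) \<mu>x(2)] c[OF u] by simp
  next
    fix f assume f: "f \<in> Cc (gtop G)"
    obtain K where K: "compactin (gtop G) K" and f0: "\<forall>p \<in> topspace (gtop G) - K. f p = 0"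
      using Cc_Hausdorff[OF Hausdorff_arrows f] by blast
    show "(\<lambda>u. \<integral>a. f a \<partial>\<alpha> u) \<in> Cc (unit_top G)"
    proof (rule Cc.generator)
      show "openin (unit_top G) (topspace (unit_top G))" "Hausdorff_space (subtopology (unit_top G) (topspace (unit_top G)))"
        using Hausdorff_units by simp_all
      show "compactin (unit_top G) (r ` K)"
        using image_compactin[OF K rng_continuous] .
      then show "r ` K \<subseteq> topspace (unit_top G)"
        by (rule compactin_subset_topspace)
      show "(\<integral>a. f a \<partial>\<alpha> u) = 0" if "u \<in> topspace (unit_top G) - r ` K" for u
      proof -
        have u: "u \<in> units G" "u \<notin> r ` K"
          using that by (auto simp: topspace_unit_top)
        have "(\<integral>a. f a \<partial>\<alpha> u) = (\<integral>a. f (c u \<cdot> a) \<partial>\<mu>)"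
          unfolding \<alpha>_def
          by (rule integral_translate[OF c(1)[OF u(1)] \<mu>x(1)[OF c(3)[OF u(1)]] Cc_borel_measurable[OF f]])
        also have "\<dots> = (\<integral>a. 0 \<partial>\<mu>)"
        proof (rule Bochner_Integration.integral_cong[OF refl])
          fix a assume "a \<in> space \<mu>"
          then have "c u \<cdot> a \<in> arrows G" "r (c u \<cdot> a) = u"
            using c[OF u(1)] mult_rfib(1)[of "c u" a] radon_measure_space[OF \<mu>(1)]
            by (auto simp: topspace_rfib_top rfib_iff)
          moreover from this have "c u \<cdot> a \<notin> K"
            using u(2) by (metis imageI)
          ultimately show "f (c u \<cdot> a) = 0"
            using f0 by (simp add: topspace_gtop)
        qed
        finally show ?thesis
          by simp
      qed
      have "continuous_map (unit_top G) euclidean (\<lambda>u. \<integral>a. f a \<partial>\<alpha> u)"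
      proof (rule continuous_map_euclideanI)
        fix u and e :: real assume "u \<in> topspace (unit_top G)" and e: "0 < e"
        then have u: "u \<in> units G"
          by (simp add: topspace_unit_top)
        obtain U where U: "openin (unit_top G) U" "r (c u) \<in> U"
          and near: "\<And>v. v \<in> U \<Longrightarrow> \<exists>d \<in> arrows G. r d = v \<and> s d = s (c u) \<and>
            dist (\<integral>a. f a \<partial>translate \<mu> d) (\<integral>a. f a \<partial>translate \<mu> (c u)) < e"
          using translate_integral_continuous_at[OF c(1)[OF u] \<mu>x(1)[OF c(3)[OF u]] f e] by blast
        have "dist (\<integral>a. f a \<partial>\<alpha> v) (\<integral>a. f a \<partial>\<alpha> u) < e" if v: "v \<in> U" for v
        proof -
          obtain d where d: "d \<in> arrows G" "r d = v" "s d = x"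
            "dist (\<integral>a. f a \<partial>translate \<mu> d) (\<integral>a. f a \<partial>translate \<mu> (c u)) < e"
            using near[OF v] c(3)[OF u] by auto
          have "v \<in> units G"
            using v openin_subset[OF U(1)] by (auto simp: topspace_unit_top)
          \<comment> \<open>The nearby arrow \<open>d\<close> comes from a local section and is in
            general not \<open>c v\<close>, but it gives the same measure.\<close>
          from \<alpha>_eq[OF this d(1,2,3)] d(4) show ?thesis
            by (simp add: \<alpha>_def[of u])
        qed
        then show "\<exists>U. openin (unit_top G) U \<and> u \<in> U \<and>
            (\<forall>v \<in> U. dist (\<integral>a. f a \<partial>\<alpha> v) (\<integral>a. f a \<partial>\<alpha> u) < e)"
          using U c(2)[OF u] by auto
      qed
      then show "continuous_map (subtopology (unit_top G) (topspace (unit_top G))) euclidean (\<lambda>u. \<integral>a. f a \<partial>\<alpha> u)"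
        by simp
    qed
  next
    fix g f assume g: "g \<in> arrows G" and f: "f \<in> Cc (gtop G)"
    have cf: "continuous_map (gtop G) euclidean f"
      using Cc_Hausdorff[OF Hausdorff_arrows f] by blast
    let ?v = "s g" and ?u = "r g"
    have v: "?v \<in> units G" and u: "?u \<in> units G"
      using arrow_props[OF g] by auto
    \<comment> \<open>The product is another arrow with source \<open>x\<close> and range
      \<open>r g\<close>, so left invariance becomes associativity followed by independence of the
      arrow.\<close>
    have gc: "g \<cdot> c ?v \<in> arrows G" "r (g \<cdot> c ?v) = ?u" "s (g \<cdot> c ?v) = x"
      using g c[OF v] by (simp_all add: mult_props)
    have cfg: "continuous_map (rfib_top G (r (c ?v))) euclidean (\<lambda>a. f (g \<cdot> a))"
      using continuous_map_compose[OF continuous_map_rfib_topD[OF left_mult_continuous[OF g]] cf] c(2)[OF v]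
      by (simp add: o_def)
    have "(LINT a:rfib G ?v|\<alpha> ?v. f (g \<cdot> a)) = (\<integral>a. f (g \<cdot> (c ?v \<cdot> a)) \<partial>\<mu>)"
      using set_integral_translate[OF c(1)[OF v] \<mu>x(1)[OF c(3)[OF v]] cfg] c(2)[OF v] by (simp add: \<alpha>_def)
    also have "\<dots> = (\<integral>a. f (g \<cdot> c ?v \<cdot> a) \<partial>\<mu>)"
      using g c[OF v] radon_measure_space[OF \<mu>(1)]
      by (intro Bochner_Integration.integral_cong) (auto simp: topspace_rfib_top rfib_iff mult_assoc)
    also have "\<dots> = (LINT a:rfib G (r (g \<cdot> c ?v))|translate \<mu> (g \<cdot> c ?v). f a)"
      by (rule set_integral_translate[OF gc(1) \<mu>x(1)[OF gc(3)], symmetric])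
        (simp add: rfib_top_def continuous_map_from_subtopology[OF cf])
    also have "\<dots> = (LINT a:rfib G ?u|\<alpha> ?u. f a)"
      by (simp only: gc(2) \<alpha>_eq[OF u gc])
    finally show "(LINT a:rfib G ?v|\<alpha> ?v. f (g \<cdot> a)) = (LINT a:rfib G ?u|\<alpha> ?u. f a)" .
  qed
qed

end

theorem theorem2p4:
  fixes G :: "'a top_groupoid" and x :: 'a
  assumes "locally_compact_groupoid G" and "locally_trivial G" and "x \<in> units G"
  defines "S1 \<equiv> \<exists>\<alpha>. haar_system G \<alpha>"
    and "S2 \<equiv> \<exists>\<mu>. radon_measure (rfib_top G x) \<mu> \<and> fully_supported (rfib_top G x) \<mu> \<and>
                  isotropy_invariant G x \<mu>"
    and "S3 \<equiv> \<exists>\<mu>. radon_measure (unit_top G) \<mu> \<and> fully_supported (unit_top G) \<mu>"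
  shows "(S1 \<longleftrightarrow> S2) \<and> (S3 \<longrightarrow> S2) \<and> (paracompact_space (unit_top G) \<longrightarrow> S2 \<longrightarrow> S3)"
proof -
  interpret lt_groupoid G
    using assms(1,2) by unfold_locales
  have "S1 \<Longrightarrow> S2"
    unfolding S1_def S2_def using invariant_measure_of_haar_system[OF assms(3)] by metis
  moreover have "S2 \<Longrightarrow> S1"
    unfolding S1_def S2_def using haar_system_of_invariant_measure[OF assms(3)] by metis
  moreover have "S3 \<Longrightarrow> S2"
    unfolding S2_def S3_def using invariant_measure_of_unit_measure[OF assms(3)] by metis
  moreover have "S2 \<Longrightarrow> S3"
    unfolding S2_def S3_def using unit_measure_of_invariant_measure[OF assms(3)] by metis
  ultimately show ?thesis
    by blast
qed

end
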